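(* Let $(\mathcal A,\varphi)$ be a noncommutative probability space over a commutative ring $\mathbb K$, let $I$ be an index set, let $(X_i)_{i\in I}$ be elements of $\mathcal A$, and let $\boldsymbol{\tau}\colon\mathsf{BPT}(I)\to\mathbb K$ be a weighted troupe. The following are equivalent: (i) for all $n\ge1$ and all $i_1,\dots,i_n\in I$, $-K_n(X_{i_1},\dots,X_{i_n})=\sum_{T\in\mathsf{DBPT}(i_1,\dots,i_n)}\boldsymbol{\tau}(T)$; (ii) for all $n\ge1$ and all $i_1,\dots,i_n\in I$, $-R_n(X_{i_1},\dots,X_{i_n})=\sum_{T\in\mathsf{BPT}(i_1,\dots,i_n)}\boldsymbol{\tau}(T)$; (iii) for all $n\ge1$ and all $i_1,\dots,i_n\in I$, $-B_n(X_{i_1},\dots,X_{i_n})=\sum_{T\in\mathsf{Branch}(i_1,\dots,i_n)}\boldsymbol{\tau}(T)$.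
   Context: A noncommutative probability space over $\mathbb K$ is a pair $(\mathcal A,\varphi)$ where $\mathcal A$ is a unital associative $\mathbb K$-algebra and $\varphi\colon\mathcal A\to\mathbb K$ is a $\mathbb K$-linear map with $\varphi(1)=1$. For $n\ge1$, the classical, free and Boolean cumulants $K_n,R_n,B_n\colon\mathcal A^n\to\mathbb K$ are the unique multilinear functionals such that for all $n\ge1$ and $X_1,\dots,X_n\in\mathcal A$: $\varphi(X_1\cdots X_n)=\sum_{\pi\in\Pi(n)}K_\pi=\sum_{\pi\in\mathrm{NC}(n)}R_\pi=\sum_{\pi\in\mathrm{Int}(n)}B_\pi$, where $\Pi(n)$ is the set of all set partitions of $[n]=\{1,\dots,n\}$; $\mathrm{NC}(n)$ is the set of noncrossing ones (no $a<b<c<d$ with $a,c$ in one block and $b,d$ in a different block); $\mathrm{Int}(n)$ is the set of interval partitions (every block is a set of consecutive integers); and $K_\pi=\prod_{U\in\pi}K_U$, where for $U=\{u_1<\dots<u_k\}$, $K_U=K_k(X_{u_1},\dots,X_{u_k})$ (similarly $R_\pi$, $B_\pi$). A binary plane tree is a rooted tree in which each child of a vertex is a left child or a right child, no vertex having more than one of each; trees are up to isomorphism and the empty tree $\varnothing$ is allowed. A branch is a nonempty binary plane tree in which every vertex has at most one child. Postorder on a tree: for each vertex $v$, all vertices of its left subtree precede all vertices of its right subtree, which precede $v$. Let $\boxminus$ be a special symbol. An $I$-coloring of a tree $T$ is a function $\chi\colon T\sqcup\{\boxminus\}\to I$; $\mathsf{BPT}(I)$ is the set of $I$-colored binary plane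 trees (including $\varnothing$). For $i_1,\dots,i_n\in I$: $\mathsf{BPT}(i_1,\dots,i_n)$ is the set of $I$-colored binary plane trees with $n-1$ vertices whose vertex colors read in postorder are $i_1,\dots,i_{n-1}$ and with $\chi(\boxminus)=i_n$; $\mathsf{Branch}(i_1,\dots,i_n)$ is the set of branches in $\mathsf{BPT}(i_1,\dots,i_n)$; $\mathsf{DBPT}(i_1,\dots,i_n)$ is the set of $I$-colored binary plane trees $T$ with $n-1$ vertices equipped with a decreasing standard labeling $\mathcal L\colon T\to[n-1]$ (a bijection with each vertex's label larger than its children's labels) such that $\chi(v)=i_{\mathcal L(v)}$ for all vertices $v$ and $\chi(\boxminus)=i_n$; two such labeled trees are identified iff there is a label- and color-preserving isomorphism. For $T\in\mathsf{DBPT}(i_1,\dots,i_n)$, $\boldsymbol{\tau}(T)$ means $\boldsymbol{\tau}$ of the underlying $I$-colored tree. Insertion: for nonempty $I$-colored trees $T_1,T_2$ with colorings $\chi_1,\chi_2$ and a vertex $v$ of $T_1$, $\nabla_v(T_1,T_2)$ is formed by creating a new vertex $v^*$ taking the place of $v$ in $T_1$, making $v$ (with its subtrees) the left child of $v^*$, and attaching $T_2$ as the right subtree of $v^*$; the coloring is $\chi_1$ on $T_1\sqcup\{\boxminus\}$, $\chi_2$ on vertices of $T_2$, and $v^*$ gets color $\chi_2(\boxminus)$. A weighted troupe is a function $\boldsymbol{\tau}\colon\mathsf{BPT}(I)\to\mathbb K$ with $\boldsymbol{\tau}(\varnothing)=0$ and $\boldsymbol{\tau}(\nabla_v(T_1,T_2))=\boldsymbol{\tau}(T_1)\boldsymbol{\tau}(T_2)$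 for all nonempty $T_1,T_2$ and vertices $v$ of $T_1$. *)

theory Defs
  imports Main "HOL-Library.Tree" "HOL-Library.Disjoint_Sets"
begin

definition nc_prob_space ::
  "('k::comm_ring_1 \<Rightarrow> 'a::ring_1 \<Rightarrow> 'a) \<Rightarrow> ('a \<Rightarrow> 'k) \<Rightarrow> bool" where
  "nc_prob_space scl phi \<longleftrightarrow>
     (\<forall>c x y. scl c (x + y) = scl c x + scl c y) \<and>
     (\<forall>c d x. scl (c + d) x = scl c x + scl d x) \<and>
     (\<forall>c d x. scl (c * d) x = scl c (scl d x)) \<and>
     (\<forall>x. scl 1 x = x) \<and>
     (\<forall>c x y. scl c (x * y) = scl c x * y) \<and>
     (\<forall>c x y. scl c (x * y) = x * scl c y) \<and>
     (\<forall>x y. phi (x + y) = phi x + phi y) \<and>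
     (\<forall>c x. phi (scl c x) = c * phi x) \<and>
     phi 1 = 1"

definition set_partitions :: "nat \<Rightarrow> nat set set set" where
  "set_partitions n = {P. partition_on {..<n} P}"

definition noncrossing :: "nat set set \<Rightarrow> bool" where
  "noncrossing P \<longleftrightarrow> \<not> (\<exists>U\<in>P. \<exists>V\<in>P. U \<noteq> V \<and>
      (\<exists>a b c d. a < b \<and> b < c \<and> c < d \<and> a \<in> U \<and> c \<in> U \<and> b \<in> V \<and> d \<in> V))"

definition interval_partition :: "nat set set \<Rightarrow> bool" where
  "interval_partition P \<longleftrightarrow>
     (\<forall>U\<in>P. \<forall>x y z. x \<in> U \<longrightarrow> z \<in> U \<longrightarrow> x \<le> y \<longrightarrow> y \<le> z \<longrightarrow> y \<in> U)"

definition nc_partitions :: "nat \<Rightarrow> nat set set set" where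
  "nc_partitions n = {P \<in> set_partitions n. noncrossing P}"

definition int_partitions :: "nat \<Rightarrow> nat set set set" where
  "int_partitions n = {P \<in> set_partitions n. interval_partition P}"

text \<open>A multilinear functional in n arguments for every n is represented
by a function on lists of algebra elements. The block product
C_pi(x_1,...,x_n) = prod over blocks U of C applied to the subsequence indexed by U.\<close>

definition block_prod :: "('a list \<Rightarrow> 'k::comm_ring_1) \<Rightarrow> 'a list \<Rightarrow> nat set set \<Rightarrow> 'k" where
  "block_prod C xs P = (\<Prod>U\<in>P. C (map (\<lambda>j. xs ! j) (sorted_list_of_set U)))"

text \<open>Cumulants are characterised (uniquely) by the moment-cumulant formulas
phi(x_1...x_n) = sum over partitions, for all n >= 1 and all x_1,...,x_n.\<close>

definition cumulants_wrt ::
  "(nat \<Rightarrow> nat set set set) \<Rightarrow> ('a::ring_1 \<Rightarrow> 'k::comm_ring_1) \<Rightarrow> ('a list \<Rightarrow> 'k) \<Rightarrow> bool" where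
  "cumulants_wrt Parts phi C \<longleftrightarrow>
     (\<forall>xs. xs \<noteq> [] \<longrightarrow> phi (prod_list xs) = (\<Sum>P\<in>Parts (length xs). block_prod C xs P))"

definition classical_cumulants where "classical_cumulants = cumulants_wrt set_partitions"
definition free_cumulants where "free_cumulants = cumulants_wrt nc_partitions"
definition boolean_cumulants where "boolean_cumulants = cumulants_wrt int_partitions"

text \<open>An I-colored binary plane tree is a pair (t, c): t :: 'i tree gives the
tree shape with vertex colors, c is the color of the special symbol boxminus.
The index set I is the type 'i.\<close>

type_synonym 'i cbpt = "'i tree \<times> 'i"

fun positions :: "'a tree \<Rightarrow> bool list set" where
  "positions Leaf = {}"
| "positions (Node l x r) = {[]} \<union> Cons False ` positions l \<union> Cons True ` positions r"

fun ins_at :: "bool list \<Rightarrow> 'a tree \<Rightarrow> 'a tree \<Rightarrow> 'a \<Rightarrow> 'a tree" where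
  "ins_at [] (Node l x r) t2 c = Node (Node l x r) c t2"
| "ins_at (False # p) (Node l x r) t2 c = Node (ins_at p l t2 c) x r"
| "ins_at (True # p) (Node l x r) t2 c = Node l x (ins_at p r t2 c)"
| "ins_at _ Leaf t2 c = Leaf"

definition insertion :: "bool list \<Rightarrow> 'i cbpt \<Rightarrow> 'i cbpt \<Rightarrow> 'i cbpt" where
  "insertion p T1 T2 = (ins_at p (fst T1) (fst T2) (snd T2), snd T1)"

definition weighted_troupe :: "('i cbpt \<Rightarrow> 'k::comm_ring_1) \<Rightarrow> bool" where
  "weighted_troupe tau \<longleftrightarrow>
     (\<forall>c. tau (Leaf, c) = 0) \<and>
     (\<forall>T1 T2 p. fst T1 \<noteq> Leaf \<longrightarrow> fst T2 \<noteq> Leaf \<longrightarrow> p \<in> positions (fst T1) \<longrightarrow>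
         tau (insertion p T1 T2) = tau T1 * tau T2)"

definition BPT :: "'i list \<Rightarrow> 'i cbpt set" where
  "BPT is = {(t, last is) | t. postorder t = butlast is}"

fun unary :: "'a tree \<Rightarrow> bool" where
  "unary Leaf = True"
| "unary (Node l x r) = ((l = Leaf \<or> r = Leaf) \<and> unary l \<and> unary r)"

definition is_branch :: "'a tree \<Rightarrow> bool" where
  "is_branch t \<longleftrightarrow> t \<noteq> Leaf \<and> unary t"

definition Branch :: "'i list \<Rightarrow> 'i cbpt set" where
  "Branch is = {T \<in> BPT is. is_branch (fst T)}"

text \<open>Decreasing standard labelings. A labeled colored tree in DBPT(is) is
determined (up to label- and color-preserving isomorphism) by its tree of
labels: a nat tree whose labels are exactly 0..<n-1 (0-indexed version of [n-1]),
each used once, and each label larger than the labels of its children.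
Its colors are then is ! label, and boxminus has color last is.\<close>

fun decreasing :: "nat tree \<Rightarrow> bool" where
  "decreasing Leaf = True"
| "decreasing (Node l a r) =
     ((\<forall>x\<in>set_tree l. x < a) \<and> (\<forall>x\<in>set_tree r. x < a) \<and> decreasing l \<and> decreasing r)"

definition DBPT :: "'i list \<Rightarrow> nat tree set" where
  "DBPT is = {L. distinct (inorder L) \<and> set_tree L = {..<length is - 1} \<and> decreasing L}"

definition underlying :: "'i list \<Rightarrow> nat tree \<Rightarrow> 'i cbpt" where
  "underlying is L = (map_tree (\<lambda>k. is ! k) L, last is)"

end

theory Submission
  imports Defs
begin

text \<open>
  Write words backwards, so that the derivation \<open>\<partial>\<^sub>c f = (\<lambda>u. f (c # u))\<close> strips the last letter, and let
  \<open>m\<close> be the moments. Each moment-cumulant formula takes the form \<open>\<partial>\<^sub>d m = A (\<partial>\<^sub>d \<kappa>)\<close>: in the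
  classical case \<open>A f\<close> is the subset convolution of \<open>f\<close> with \<open>m\<close>, in the free case \<open>A\<close> fills the gaps
  of a subword with \<open>m\<close>, in the Boolean case \<open>A f\<close> is the deconcatenation product of \<open>f\<close> with \<open>m\<close>.

  Let \<open>g\<^bsub>C,d\<^esub>\<close> sum \<open>\<tau>\<close> over the (decreasing or plane) trees hanging below a fixed chain \<open>C\<close> of
  unary vertices, and split off the root: a root with two children contributes the product
  \<open>g\<^bsub>[],c\<^esub> \<star> g\<^bsub>C,d\<^esub>\<close> by the troupe identity, a root with one child only prolongs the chain. If
  \<open>\<partial>\<^sub>c m = - A g\<^bsub>[],c\<^esub>\<close>, the Leibniz rule for \<open>A\<close> cancels exactly the two-children term, so that
  \<open>A g\<^bsub>C,d\<^esub>\<close> satisfies the recursion of the sum over branches, deconcatenated with \<open>m\<close>. Hence the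
  classical and the free recursion with tree cumulants are both equivalent to the Boolean one
  with branch cumulants.
\<close>

subsection \<open>Convolutions of functions on words\<close>

text \<open>The convolution for the unshuffling coproduct, defined by the Leibniz rule for stripping
  the first letter; \<open>shuf_sum\<close> gives the closed form over subsets.\<close>

primrec shuf :: "('i list \<Rightarrow> 'k::comm_ring_1) \<Rightarrow> ('i list \<Rightarrow> 'k) \<Rightarrow> 'i list \<Rightarrow> 'k" where
  "shuf f g [] = f [] * g []"
| "shuf f g (c # w) = shuf (\<lambda>u. f (c # u)) g w + shuf f (\<lambda>u. g (c # u)) w"

primrec deconc :: "('i list \<Rightarrow> 'k::comm_ring_1) \<Rightarrow> ('i list \<Rightarrow> 'k) \<Rightarrow> 'i list \<Rightarrow> 'k" where
  "deconc f g [] = f [] * g []"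
| "deconc f g (c # w) = f [] * g (c # w) + deconc (\<lambda>u. f (c # u)) g w"

text \<open>\<open>gap m \<mu> f w\<close> sums, over all subwords \<open>u\<close> of \<open>w\<close>, \<open>f u\<close> times the weights of the maximal factors of
  \<open>w\<close> outside \<open>u\<close>: the first factor has weight \<open>\<mu>\<close> and the others have weight \<open>m\<close>.\<close>

primrec gap :: "('i list \<Rightarrow> 'k::comm_ring_1) \<Rightarrow> ('i list \<Rightarrow> 'k) \<Rightarrow> ('i list \<Rightarrow> 'k) \<Rightarrow> 'i list \<Rightarrow> 'k" where
  "gap m \<mu> f [] = \<mu> [] * f []"
| "gap m \<mu> f (c # w) = gap m (\<lambda>u. \<mu> (c # u)) f w + \<mu> [] * gap m m (\<lambda>u. f (c # u)) w"

abbreviation unit_at_nil :: "'k::comm_ring_1 \<Rightarrow> 'i list \<Rightarrow> 'k" where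
  "unit_at_nil x \<equiv> (\<lambda>u. if u = [] then x else 0)"

lemma shuf_cong:
  assumes "\<And>u. length u \<le> length w \<Longrightarrow> f u = f' u" "\<And>u. length u \<le> length w \<Longrightarrow> g u = g' u"
  shows "shuf f g w = shuf f' g' w"
  using assms
proof (induction w arbitrary: f g f' g')
  case (Cons c w)
  have "shuf (\<lambda>u. f (c # u)) g w = shuf (\<lambda>u. f' (c # u)) g' w"
    using Cons.prems by (intro Cons.IH) simp_all
  moreover have "shuf f (\<lambda>u. g (c # u)) w = shuf f' (\<lambda>u. g' (c # u)) w"
    using Cons.prems by (intro Cons.IH) simp_all
  ultimately show ?case by simp
qed simp

lemma shuf_commute: "shuf f g w = shuf g f w"
  by (induction w arbitrary: f g) (simp_all add: mult.commute add.commute)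

lemma shuf_add: "shuf (\<lambda>u. f u + g u) h w = shuf f h w + shuf g h w"
  by (induction w arbitrary: f g h) (simp_all add: algebra_simps)

lemma shuf_add_right: "shuf h (\<lambda>u. f u + g u) w = shuf h f w + shuf h g w"
  by (simp add: shuf_commute[of h] shuf_add)

lemma shuf_zero [simp]: "shuf (\<lambda>u. 0) g w = 0"
  by (induction w arbitrary: g) simp_all

lemma shuf_uminus_right: "shuf h (\<lambda>u. - f u) w = - shuf h f w"
  by (induction w arbitrary: f h) simp_all

lemma shuf_unit_at_nil: "shuf (unit_at_nil x) g w = x * g w"
  by (induction w arbitrary: g) simp_all

lemma shuf_assoc: "shuf (shuf f g) h w = shuf f (shuf g h) w"
  by (induction w arbitrary: f g h) (simp_all add: algebra_simps shuf_add shuf_add_right)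

text \<open>Triangularity: every summand but one evaluates \<open>f\<close> on a proper subword.
  This and its analogues for \<open>deconc\<close> and \<open>gap\<close> make the transforms below
  invertible.\<close>

lemma shuf_leading:
  assumes "\<And>u. length u < length w \<Longrightarrow> f u = 0"
  shows "shuf f g w = f w * g []"
  using assms
proof (induction w arbitrary: f g)
  case (Cons c w)
  have "shuf f (\<lambda>u. g (c # u)) w = shuf (\<lambda>u. 0) (\<lambda>u. g (c # u)) w"
    using Cons.prems by (intro shuf_cong) auto
  moreover have "shuf (\<lambda>u. f (c # u)) g w = f (c # w) * g []"
    using Cons.prems by (intro Cons.IH) simp
  ultimately show ?case by simp
qed simp

lemma deconc_cong:
  assumes "\<And>u. length u \<le> length w \<Longrightarrow> f u = f' u" "\<And>u. length u \<le> length w \<Longrightarrow> g u = g' u"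
  shows "deconc f g w = deconc f' g' w"
  using assms
proof (induction w arbitrary: f f')
  case (Cons c w)
  have "deconc (\<lambda>u. f (c # u)) g w = deconc (\<lambda>u. f' (c # u)) g' w"
    using Cons.prems by (intro Cons.IH) simp_all
  with Cons.prems show ?case by simp
qed simp

lemma deconc_add: "deconc (\<lambda>u. f u + g u) h w = deconc f h w + deconc g h w"
  by (induction w arbitrary: f g) (simp_all add: algebra_simps)

lemma deconc_scale: "deconc (\<lambda>u. x * f u) h w = x * deconc f h w"
  by (induction w arbitrary: f) (simp_all add: algebra_simps)

lemma deconc_uminus: "deconc (\<lambda>u. - f u) h w = - deconc f h w"
  by (induction w arbitrary: f) simp_all

lemma deconc_zero [simp]: "deconc (\<lambda>u. 0) h w = 0"
  by (induction w) simp_all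

lemma deconc_unit_at_nil: "deconc (unit_at_nil x) g w = x * g w"
  by (induction w) simp_all

lemma deconc_unit_at_nil_right: "deconc f (unit_at_nil x) w = f w * x"
  by (induction w arbitrary: f) simp_all

lemma deconc_leading:
  assumes "\<And>u. length u < length w \<Longrightarrow> f u = 0"
  shows "deconc f g w = f w * g []"
  using assms by (induction w arbitrary: f) auto

lemma deconc_sum: "deconc f g w = (\<Sum>i\<le>length w. f (take i w) * g (drop i w))"
  by (induction w arbitrary: f) (simp_all add: sum.atMost_Suc_shift del: sum.atMost_Suc)

lemma gap_add: "gap m \<mu> (\<lambda>u. f u + g u) w = gap m \<mu> f w + gap m \<mu> g w"
  by (induction w arbitrary: \<mu> f g) (simp_all add: algebra_simps)

lemma gap_scale: "gap m \<mu> (\<lambda>u. x * f u) w = x * gap m \<mu> f w"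
  by (induction w arbitrary: \<mu> f) (simp_all add: algebra_simps)

lemma gap_zero [simp]: "gap m \<mu> (\<lambda>u. 0) w = 0"
  by (induction w arbitrary: \<mu>) simp_all

lemma gap_zero_left [simp]: "gap m (\<lambda>u. 0) f w = 0"
  by (induction w) simp_all

lemma gap_unit_at_nil: "gap m \<mu> (unit_at_nil x) w = x * \<mu> w"
  by (induction w arbitrary: \<mu>) simp_all

lemma gap_cong:
  assumes "\<And>u. length u \<le> length w \<Longrightarrow> f u = f' u"
  shows "gap m \<mu> f w = gap m \<mu> f' w"
  using assms
proof (induction w arbitrary: \<mu> f f')
  case (Cons c w)
  have "gap m (\<lambda>u. \<mu> (c # u)) f w = gap m (\<lambda>u. \<mu> (c # u)) f' w"
    using Cons.prems by (intro Cons.IH) simp_all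
  moreover have "gap m m (\<lambda>u. f (c # u)) w = gap m m (\<lambda>u. f' (c # u)) w"
    using Cons.prems by (intro Cons.IH) simp_all
  ultimately show ?case by simp
qed simp

lemma gap_leading:
  assumes "\<And>u. length u < length w \<Longrightarrow> f u = 0" "m [] = 1"
  shows "gap m \<mu> f w = \<mu> [] * f w"
  using assms(1)
proof (induction w arbitrary: f \<mu>)
  case (Cons c w)
  have "gap m (\<lambda>u. \<mu> (c # u)) f w = gap m (\<lambda>u. \<mu> (c # u)) (\<lambda>u. 0) w"
    using Cons.prems by (intro gap_cong) auto
  moreover have "gap m m (\<lambda>u. f (c # u)) w = m [] * f (c # w)"
    using Cons.prems by (intro Cons.IH) simp
  ultimately show ?case using assms(2) by simp
qed simp

text \<open>The first gap is a prefix of \<open>w\<close> and can be cut off. In the remainder the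
  weight \<open>unit_at_nil 1\<close> forces the first gap to be empty.\<close>

lemma gap_eq_deconc: "gap m \<mu> f w = deconc \<mu> (gap m (unit_at_nil 1) f) w"
  by (induction w arbitrary: \<mu>) simp_all

text \<open>Let the chosen subword be split in two. Cutting \<open>w\<close> just before the first
  letter of the second piece (at the end of \<open>w\<close> if that piece is empty) assigns the gap
  between the pieces to the first factor; \<open>unit_at_nil 1\<close> makes this cut
  unique.\<close>

lemma gap_deconc: "gap m \<mu> (deconc q f) w = deconc (gap m \<mu> q) (gap m (unit_at_nil 1) f) w"
  by (induction w arbitrary: \<mu> q)
    (simp_all add: gap_add gap_scale deconc_add deconc_scale algebra_simps)

text \<open>The subwords are sorted by the position \<open>i\<close> of their first letter; the
  extra term is the empty subword.\<close>

lemma gap_sum: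
  "gap m \<mu> f w = \<mu> w * f [] + (\<Sum>i<length w. \<mu> (take i w) * gap m m (\<lambda>u. f (w ! i # u)) (drop (Suc i) w))"
  by (induction w arbitrary: \<mu>)
    (simp_all add: sum.lessThan_Suc_shift algebra_simps del: sum.lessThan_Suc)

section \<open>The cancellation argument for an abstract transform\<close>

text \<open>\<open>leading\<close> makes \<open>A\<close> unitriangular with respect to length.
  \<open>leibniz\<close> asks for the recursion of \<open>m\<close> only up to the length of
  \<open>w\<close>, so that it is available inside an induction that is still proving this
  recursion.\<close>

locale cumulant_transform =
  fixes m :: "'i list \<Rightarrow> 'k::comm_ring_1"
    and A :: "('i list \<Rightarrow> 'k) \<Rightarrow> 'i list \<Rightarrow> 'k"
    and star :: "('i list \<Rightarrow> 'k) \<Rightarrow> ('i list \<Rightarrow> 'k) \<Rightarrow> 'i list \<Rightarrow> 'k"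
  assumes m_Nil: "m [] = 1"
    and add: "A (\<lambda>u. f u + g u) w = A f w + A g w"
    and unit: "A (unit_at_nil x) w = x * m w"
    and leading: "(\<And>u. length u < length w \<Longrightarrow> f u = 0) \<Longrightarrow> A f w = f w"
    and leibniz: "(\<And>c v. length v \<le> length w \<Longrightarrow> m (c # v) = - A (q c) v) \<Longrightarrow>
      A f (c # w) = A (\<lambda>u. f (c # u)) w - A (star (q c) f) w"
begin

lemma injective:
  assumes "\<And>w. A f w = A g w"
  shows "f w = g w"
proof (induction w rule: length_induct)
  case (1 w)
  have "A (\<lambda>u. f u - g u) w + A g w = A f w"
    by (simp flip: add)
  moreover have "A (\<lambda>u. f u - g u) w = f w - g w"
    using 1 by (intro leading) simp
  ultimately show ?case
    using assms[of w] by (metis add_cancel_left_left right_minus_eq)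
qed

lemma uminus: "A (\<lambda>u. - f u) w = - A f w"
proof -
  have "A (\<lambda>u. f u + - f u) w = 0"
    by (subst leading) simp_all
  then show ?thesis
    by (subst (asm) add) (simp add: eq_neg_iff_add_eq_0 add.commute)
qed

end

text \<open>\<open>g C d\<close> models the sum over trees hanging below the chain \<open>C\<close>,
  with box color \<open>d\<close>; \<open>b\<close> is its analogue for branches, and
  \<open>e\<close> is the value of the chain closed off by a childless vertex. The terms of
  \<open>g_Cons\<close> belong to a root with two children, only a left one, only a right one, none;
  \<open>b_Cons\<close> lacks the first.\<close>

locale chain_family = cumulant_transform m A star
  for m :: "'i list \<Rightarrow> 'k::comm_ring_1" and A star +
  fixes g b :: "(bool \<times> 'i) list \<Rightarrow> 'i \<Rightarrow> 'i list \<Rightarrow> 'k"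
    and e :: "(bool \<times> 'i) list \<Rightarrow> 'i \<Rightarrow> 'i \<Rightarrow> 'k"
  assumes g_Nil: "g C d [] = 0"
    and g_Cons: "g C d (c # w) = star (g [] c) (g C d) w + g (C @ [(False, c)]) d w
      + g (C @ [(True, c)]) d w + unit_at_nil (e C d c) w"
    and b_Nil: "b C d [] = 0"
    and b_Cons: "b C d (c # w) = b (C @ [(False, c)]) d w
      + b (C @ [(True, c)]) d w + unit_at_nil (e C d c) w"
begin

text \<open>The Leibniz correction is exactly the two-children term of \<open>g_Cons\<close>, and
  what remains is the recursion of \<open>b\<close> deconcatenated with \<open>m\<close>. The chain
  grows at each step, hence the induction for all \<open>C\<close>.\<close>

lemma transform_eq:
  assumes "\<And>c v. length v < length w \<Longrightarrow> m (c # v) = - A (g [] c) v"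
  shows "A (g C d) w = deconc (b C d) m w"
  using assms
proof (induction w arbitrary: C)
  case Nil
  have "A (g C d) [] = g C d []" by (rule leading) simp
  then show ?case by (simp add: g_Nil b_Nil)
next
  case (Cons c w)
  have "A (g C d) (c # w) = A (\<lambda>u. g C d (c # u)) w - A (star (g [] c) (g C d)) w"
    using Cons.prems by (intro leibniz) simp
  also have "\<dots> = A (g (C @ [(False, c)]) d) w + A (g (C @ [(True, c)]) d) w + e C d c * m w"
    by (simp add: g_Cons add unit)
  also have "\<dots> = deconc (b (C @ [(False, c)]) d) m w + deconc (b (C @ [(True, c)]) d) m w + e C d c * m w"
    using Cons by simp
  also have "\<dots> = deconc (b C d) m (c # w)"
    by (simp add: b_Nil b_Cons deconc_add deconc_unit_at_nil)
  finally show ?case .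
qed

lemma moments_iff:
  "(\<forall>c v. m (c # v) = - A (g [] c) v) \<longleftrightarrow> (\<forall>c v. m (c # v) = - deconc (b [] c) m v)"
proof
  assume "\<forall>c v. m (c # v) = - A (g [] c) v"
  then show "\<forall>c v. m (c # v) = - deconc (b [] c) m v"
    using transform_eq by metis
next
  assume *: "\<forall>c v. m (c # v) = - deconc (b [] c) m v"
  \<comment> \<open>\<open>transform_eq\<close> at \<open>v\<close> needs the recursion only on
    words shorter than \<open>v\<close>, so the formula bootstraps by length.\<close>
  have "\<forall>c. m (c # v) = - A (g [] c) v" for v
  proof (induction v rule: length_induct)
    case (1 v)
    then show ?case using * transform_eq[of v] by simp
  qed
  then show "\<forall>c v. m (c # v) = - A (g [] c) v" by simp
qed

text \<open>Unitriangularity on both sides: injectivity of \<open>A\<close> turns equality of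
  transforms into equality of \<open>R\<close> and tree sums, deconcatenation with \<open>m\<close>
  does the same for \<open>B\<close>, and \<open>moments_iff\<close> links the two.\<close>

lemma cumulants_iff:
  assumes R: "\<And>d w. m (d # w) = A (\<lambda>u. R (d # u)) w"
    and B: "\<And>d w. m (d # w) = deconc (\<lambda>u. B (d # u)) m w"
  shows "(\<forall>d w. - R (d # w) = g [] d w) \<longleftrightarrow> (\<forall>d w. - B (d # w) = b [] d w)"
proof -
  have "(\<forall>d w. - R (d # w) = g [] d w) \<longleftrightarrow> (\<forall>d w. R (d # w) = - g [] d w)"
    by (metis minus_minus)
  also have "\<dots> \<longleftrightarrow> (\<forall>d w. m (d # w) = - A (g [] d) w)"
  proof
    assume *: "\<forall>d w. m (d # w) = - A (g [] d) w"
    show "\<forall>d w. R (d # w) = - g [] d w"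
      using * R by (intro allI injective[of "\<lambda>u. R (_ # u)"]) (simp add: uminus)
  qed (simp add: R uminus)
  also have "\<dots> \<longleftrightarrow> (\<forall>d w. m (d # w) = - deconc (b [] d) m w)"
    by (rule moments_iff)
  also have "\<dots> \<longleftrightarrow> (\<forall>d w. - B (d # w) = b [] d w)"
  proof
    assume *: "\<forall>d w. m (d # w) = - deconc (b [] d) m w"
    have "\<forall>d. - B (d # w) = b [] d w" for w
    proof (induction w rule: length_induct)
      case (1 w)
      show ?case
      proof
        fix d
        \<comment> \<open>The function \<open>B + b\<close> vanishes on shorter words by induction,
          so its deconcatenation with \<open>m\<close> reduces to its value at \<open>w\<close>
          times \<open>m [] = 1\<close>.\<close>
        have "deconc (\<lambda>u. B (d # u) + b [] d u) m w = 0"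
          using * by (simp add: deconc_add flip: B)
        moreover have "deconc (\<lambda>u. B (d # u) + b [] d u) m w = (B (d # w) + b [] d w) * m []"
        proof (rule deconc_leading)
          fix u :: "'i list" assume "length u < length w"
          then have "- B (d # u) = b [] d u" using 1 by blast
          then show "B (d # u) + b [] d u = 0" by (metis add.right_inverse)
        qed
        ultimately show "- B (d # w) = b [] d w"
          by (simp add: m_Nil neg_eq_iff_add_eq_0)
      qed
    qed
    then show "\<forall>d w. - B (d # w) = b [] d w" by simp
  next
    assume "\<forall>d w. - B (d # w) = b [] d w"
    then have "b [] d = (\<lambda>u. - B (d # u))" for d by auto
    then show "\<forall>d w. m (d # w) = - deconc (b [] d) m w"
      using B by (simp add: deconc_uminus)
  qed
  finally show ?thesis .
qed

end

section \<open>The classical and the free transform\<close>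

text \<open>The stripped letter belongs to \<open>f\<close> or to \<open>m\<close>. In the second
  case the recursion for \<open>m\<close> brings in \<open>q c\<close>, which associativity and
  commutativity move over to \<open>f\<close>.\<close>

lemma cumulant_transform_shuf:
  fixes m :: "'i list \<Rightarrow> 'k::comm_ring_1"
  assumes "m [] = 1"
  shows "cumulant_transform m (\<lambda>f. shuf f m) shuf"
proof
  fix f :: "'i list \<Rightarrow> 'k" and w :: "'i list" and c and q :: "'i \<Rightarrow> 'i list \<Rightarrow> 'k"
  assume *: "\<And>c v. length v \<le> length w \<Longrightarrow> m (c # v) = - shuf (q c) m v"
  have "shuf f (\<lambda>u. m (c # u)) w = shuf f (\<lambda>u. - shuf (q c) m u) w"
    using * by (intro shuf_cong) simp_all
  also have "\<dots> = - shuf (shuf f (q c)) m w"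
    by (simp add: shuf_uminus_right shuf_assoc)
  also have "shuf f (q c) = shuf (q c) f"
    by (intro ext shuf_commute)
  finally show "shuf f m (c # w) = shuf (\<lambda>u. f (c # u)) m w - shuf (shuf (q c) f) m w"
    by simp
qed (simp_all add: assms shuf_add shuf_unit_at_nil shuf_leading)

text \<open>The stripped letter is chosen or lies in the first gap. In the latter case the recursion
  for \<open>m\<close> replaces the gap weight by \<open>- gap m m (q c)\<close>, and
  \<open>gap_deconc\<close> reads the result as a gap sum of \<open>deconc (q c) f\<close>.\<close>

lemma cumulant_transform_gap:
  fixes m :: "'i list \<Rightarrow> 'k::comm_ring_1"
  assumes "m [] = 1"
  shows "cumulant_transform m (gap m m) deconc"
proof
  fix f :: "'i list \<Rightarrow> 'k" and w :: "'i list" and c and q :: "'i \<Rightarrow> 'i list \<Rightarrow> 'k"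
  assume *: "\<And>c v. length v \<le> length w \<Longrightarrow> m (c # v) = - gap m m (q c) v"
  have "gap m (\<lambda>u. m (c # u)) f w = deconc (\<lambda>u. - gap m m (q c) u) (gap m (unit_at_nil 1) f) w"
    using * by (subst gap_eq_deconc, intro deconc_cong) simp_all
  then show "gap m m f (c # w) = gap m m (\<lambda>u. f (c # u)) w - gap m m (deconc (q c) f) w"
    by (simp add: assms deconc_uminus gap_deconc)
qed (simp_all add: assms gap_add gap_unit_at_nil gap_leading)

subsection \<open>Sums over trees\<close>

definition subword :: "'a list \<Rightarrow> nat set \<Rightarrow> 'a list" where
  "subword xs U = map ((!) xs) (sorted_list_of_set U)"

lemma length_subword [simp]: "length (subword xs U) = card U"
  by (simp add: subword_def)

lemma subword_empty [simp]: "subword xs {} = []"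
  by (simp add: subword_def)

lemma subword_append: "U \<subseteq> {..<length xs} \<Longrightarrow> subword (xs @ ys) U = subword xs U"
  using finite_subset[of U "{..<length xs}"]
  by (auto simp: subword_def nth_append)

lemma sorted_list_of_set_insert_greater:
  fixes n :: "'a::linorder"
  assumes "finite U" "\<And>x. x \<in> U \<Longrightarrow> x < n"
  shows "sorted_list_of_set (insert n U) = sorted_list_of_set U @ [n]"
  by (rule strict_sorted_equal)
    (use assms in \<open>auto simp: sorted_wrt_append simp del: sorted_list_of_set_insert_remove\<close>)

lemma subword_insert_greater:
  "finite U \<Longrightarrow> (\<And>x. x \<in> U \<Longrightarrow> x < n) \<Longrightarrow> subword xs (insert n U) = subword xs U @ [xs ! n]"
  unfolding subword_def by (subst sorted_list_of_set_insert_greater) simp_all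

lemma subword_insert_length:
  assumes "U \<subseteq> {..<length xs}"
  shows "subword (xs @ [d]) (insert (length xs) U) = subword xs U @ [d]"
  using assms finite_subset[OF assms]
  by (subst subword_insert_greater) (auto simp: subword_append)

lemma map_subword: "U \<subseteq> {..<length xs} \<Longrightarrow> subword (map f xs) U = map f (subword xs U)"
  using finite_subset[of U "{..<length xs}"] by (auto simp: subword_def)

lemma sorted_list_of_set_image:
  fixes h :: "'a::linorder \<Rightarrow> 'b::linorder"
  assumes "strict_mono_on U h" "finite U"
  shows "sorted_list_of_set (h ` U) = map h (sorted_list_of_set U)"
proof (rule strict_sorted_equal)
  show "sorted_wrt (<) (map h (sorted_list_of_set U))"
    by (rule sorted_wrt_map_mono[OF strict_sorted_list_of_set])
      (use assms in \<open>auto simp: strict_mono_on_def\<close>)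
qed (use assms in auto)

lemma strict_mono_on_enum:
  "finite (S :: 'a::linorder set) \<Longrightarrow> strict_mono_on {..<card S} ((!) (sorted_list_of_set S))"
  by (auto simp: strict_mono_on_def sorted_wrt_nth_less[OF strict_sorted_list_of_set])

lemma image_enum:
  "finite (S :: 'a::linorder set) \<Longrightarrow> (!) (sorted_list_of_set S) ` {..<card S} = S"
  using nth_image[of "card S" "sorted_list_of_set S"]
  by (simp add: lessThan_atLeast0)

text \<open>The increasing enumeration of \<open>S\<close> converts positions in
  \<open>subword xs S\<close> into positions in \<open>xs\<close>, as needed for standardizing a
  partition of \<open>S\<close>.\<close>

lemma subword_enum:
  assumes "finite S" "U \<subseteq> {..<card S}"
  shows "subword xs ((!) (sorted_list_of_set S) ` U) = subword (subword xs S) U"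
proof -
  have "finite U" using assms(2) finite_subset by blast
  moreover have "strict_mono_on U ((!) (sorted_list_of_set S))"
    using strict_mono_on_enum[OF assms(1)] assms(2) by (auto simp: strict_mono_on_def)
  ultimately show ?thesis
    using assms by (auto simp: subword_def sorted_list_of_set_image)
qed

lemma sum_Pow_insert:
  assumes "finite A" "n \<notin> A"
  shows "(\<Sum>U\<in>Pow (insert n A). f U) = (\<Sum>U\<in>Pow A. f U) + (\<Sum>U\<in>Pow A. f (insert n U))"
proof -
  have "inj_on (insert n) (Pow A)"
    using assms(2) by (auto simp: inj_on_def)
  then show ?thesis
    using assms by (subst Pow_insert, subst sum.union_disjoint) (auto simp: sum.reindex)
qed

lemma shuf_sum:
  "shuf f g (rev xs) =
    (\<Sum>U\<in>Pow {..<length xs}. f (rev (subword xs U)) * g (rev (subword xs ({..<length xs} - U))))"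
\<comment> \<open>Reversal makes the last letter of \<open>xs\<close> the head on which
  \<open>shuf\<close> recurses.\<close>
proof (induction xs arbitrary: f g rule: rev_induct)
  case Nil
  then show ?case by simp
next
  case (snoc d xs)
  let ?n = "length xs"
  have *: "insert ?n {..<?n} - insert ?n U = {..<?n} - U" "insert ?n {..<?n} - U = insert ?n ({..<?n} - U)"
    if "U \<subseteq> {..<?n}" for U
    using that by auto
  show ?case
    by (simp add: snoc lessThan_Suc sum_Pow_insert * subword_insert_length subword_append add.commute)
qed

section \<open>Sums over trees, split at the root\<close>

text \<open>The properties shared by the sums over plane and over decreasing trees, where
  \<open>w\<close> is the color word read backwards. Reversed postorder visits the root, then the
  right subtree, then the left one; hence the order in \<open>star (S R) (S L)\<close>.\<close>

locale tree_sum =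
  fixes S :: "('i tree \<Rightarrow> 'k::comm_ring_1) \<Rightarrow> 'i list \<Rightarrow> 'k"
    and star :: "('i list \<Rightarrow> 'k) \<Rightarrow> ('i list \<Rightarrow> 'k) \<Rightarrow> 'i list \<Rightarrow> 'k"
  assumes S_Nil: "S G [] = G Leaf"
    and S_add: "S (\<lambda>t. G t + H t) w = S G w + S H w"
    and S_Leaf: "S (\<lambda>t. if t = Leaf then x else 0) w = unit_at_nil x w"
    and S_cong: "(\<And>l r. G (Node l c r) = H (Node l c r)) \<Longrightarrow> S G (c # w) = S H (c # w)"
    and S_Node: "(\<And>l r. G (Node l c r) = L l * R r) \<Longrightarrow> S G (c # w) = star (S R) (S L) w"
    and star_unit_left: "star (unit_at_nil x) f w = x * f w"
    and star_unit_right: "star f (unit_at_nil x) w = f w * x"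
begin

lemma S_chain:
  assumes "\<And>l r. F (Node l c r) = (if r = Leaf then G l else 0) + (if l = Leaf then H r else 0)
    + (if l = Leaf \<and> r = Leaf then x else 0)"
  shows "S F (c # w) = S G w + S H w + unit_at_nil x w"
proof -
  \<comment> \<open>\<open>one\<close> is the indicator of the empty tree. Used as a factor it
    expresses the conditions on \<open>l\<close> and \<open>r\<close>, so that each of the three
    terms becomes a product to which \<open>S_Node\<close> applies.\<close>
  define one where "one = (\<lambda>t :: 'i tree. if t = Leaf then 1 else 0 :: 'k)"
  define G' where "G' = (\<lambda>t. G (left t) * one (right t))"
  define H' where "H' = (\<lambda>t. one (left t) * H (right t))"
  define X' where "X' = (\<lambda>t. (x * one (left t)) * one (right t))"
  have one: "S one = unit_at_nil 1" "S (\<lambda>t. x * one t) = unit_at_nil x"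
    using S_Leaf[of x] by (auto simp: one_def S_Leaf if_distrib[of "(*) x"] cong: if_cong)
  have "S F (c # w) = S (\<lambda>t. (G' t + H' t) + X' t) (c # w)"
    by (rule S_cong) (auto simp: assms G'_def H'_def X'_def one_def)
  also have "\<dots> = S G' (c # w) + S H' (c # w) + S X' (c # w)"
    by (simp only: S_add)
  also have "S G' (c # w) = star (S one) (S G) w"
    by (rule S_Node) (simp add: G'_def)
  also have "S H' (c # w) = star (S H) (S one) w"
    by (rule S_Node) (simp add: H'_def)
  also have "S X' (c # w) = star (S one) (S (\<lambda>t. x * one t)) w"
    by (rule S_Node) (simp add: X'_def)
  finally show ?thesis
    by (simp add: one star_unit_left star_unit_right)
qed

end

section \<open>Chains of unary vertices and the troupe identity\<close>

fun plug :: "(bool \<times> 'i) list \<Rightarrow> 'i tree \<Rightarrow> 'i tree" where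
  "plug [] t = t"
| "plug ((False, x) # C) t = Node (plug C t) x Leaf"
| "plug ((True, x) # C) t = Node Leaf x (plug C t)"

lemma plug_append: "plug (C @ D) t = plug C (plug D t)"
  by (induction C t rule: plug.induct) simp_all

lemma plug_Node_neq_Leaf: "plug C (Node l x r) \<noteq> Leaf"
  by (cases "(C, Node l x r)" rule: plug.cases) simp_all

lemma plug_neq_Leaf: "t \<noteq> Leaf \<Longrightarrow> plug C t \<noteq> Leaf"
  by (cases t) (simp_all add: plug_Node_neq_Leaf)

lemma map_fst_in_positions: "t \<noteq> Leaf \<Longrightarrow> map fst C \<in> positions (plug C t)"
  by (induction C t rule: plug.induct) (auto elim: positions.elims simp: neq_Leaf_iff)

lemma ins_at_plug: "l \<noteq> Leaf \<Longrightarrow> ins_at (map fst C) (plug C l) r c = plug C (Node l c r)"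
  by (induction C l rule: plug.induct) (auto simp: neq_Leaf_iff)

text \<open>The value at \<open>Leaf\<close> is 0 because otherwise \<open>chain_val_Node\<close>
  would count a chain ending in a childless vertex as a left and as a right prolongation too,
  besides its last term.\<close>

definition chain_val :: "('i cbpt \<Rightarrow> 'k::comm_ring_1) \<Rightarrow> (bool \<times> 'i) list \<Rightarrow> 'i \<Rightarrow> 'i tree \<Rightarrow> 'k" where
  "chain_val tau C d t = (if t = Leaf then 0 else tau (plug C t, d))"

text \<open>The vertex with two children is the one created by inserting \<open>r\<close> at the
  root of \<open>l\<close> inside \<open>plug C l\<close>; its color \<open>c\<close> is the box
  color of the inserted tree.\<close>

lemma weighted_troupe_plug:
  assumes "weighted_troupe tau" "l \<noteq> Leaf" "r \<noteq> Leaf"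
  shows "tau (plug C (Node l c r), d) = tau (plug C l, d) * tau (r, c)"
proof -
  have "tau (insertion (map fst C) (plug C l, d) (r, c)) = tau (plug C l, d) * tau (r, c)"
    using assms map_fst_in_positions plug_neq_Leaf unfolding weighted_troupe_def by fastforce
  then show ?thesis
    using assms(2) by (simp add: insertion_def ins_at_plug)
qed

text \<open>The product can be nonzero only for two nonempty subtrees, where it is the troupe
  identity; the bracket covers a root with at most one child.\<close>

lemma chain_val_Node:
  assumes "weighted_troupe tau"
  shows "chain_val tau C d (Node l c r) = chain_val tau C d l * chain_val tau [] c r +
    ((if r = Leaf then chain_val tau (C @ [(False, c)]) d l else 0)
     + (if l = Leaf then chain_val tau (C @ [(True, c)]) d r else 0)
     + (if l = Leaf \<and> r = Leaf then tau (plug C (Node Leaf c Leaf), d) else 0))"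
  using weighted_troupe_plug[OF assms] by (auto simp: chain_val_def plug_append)

definition branch_val :: "('i cbpt \<Rightarrow> 'k::comm_ring_1) \<Rightarrow> (bool \<times> 'i) list \<Rightarrow> 'i \<Rightarrow> 'i tree \<Rightarrow> 'k" where
  "branch_val tau C d t = (if is_branch t then tau (plug C t, d) else 0)"

lemma branch_val_Node:
  "branch_val tau C d (Node l c r) =
    (if r = Leaf then branch_val tau (C @ [(False, c)]) d l else 0)
     + (if l = Leaf then branch_val tau (C @ [(True, c)]) d r else 0)
     + (if l = Leaf \<and> r = Leaf then tau (plug C (Node Leaf c Leaf), d) else 0)"
  by (auto simp: branch_val_def is_branch_def plug_append)

lemma (in tree_sum) chain_val_Cons:
  assumes "weighted_troupe tau"
  shows "S (chain_val tau C d) (c # w) = star (S (chain_val tau [] c)) (S (chain_val tau C d)) w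
    + S (chain_val tau (C @ [(False, c)]) d) w + S (chain_val tau (C @ [(True, c)]) d) w
    + unit_at_nil (tau (plug C (Node Leaf c Leaf), d)) w"
proof -
  define P where "P = (\<lambda>t. chain_val tau C d (left t) * chain_val tau [] c (right t))"
  define Q where "Q = (\<lambda>t. (if right t = Leaf then chain_val tau (C @ [(False, c)]) d (left t) else 0)
     + (if left t = Leaf then chain_val tau (C @ [(True, c)]) d (right t) else 0)
     + (if left t = Leaf \<and> right t = Leaf then tau (plug C (Node Leaf c Leaf), d) else 0))"
  have "S (chain_val tau C d) (c # w) = S (\<lambda>t. P t + Q t) (c # w)"
    by (rule S_cong) (simp add: chain_val_Node[OF assms] P_def Q_def)
  also have "\<dots> = S P (c # w) + S Q (c # w)"
    by (rule S_add)
  also have "S P (c # w) = star (S (chain_val tau [] c)) (S (chain_val tau C d)) w"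
    by (rule S_Node) (simp add: P_def)
  also have "S Q (c # w) = S (chain_val tau (C @ [(False, c)]) d) w + S (chain_val tau (C @ [(True, c)]) d) w
    + unit_at_nil (tau (plug C (Node Leaf c Leaf), d)) w"
    by (rule S_chain) (simp add: Q_def)
  finally show ?thesis by (simp add: add.assoc)
qed

section \<open>Plane trees\<close>

definition plane_sum :: "('i tree \<Rightarrow> 'k::comm_ring_1) \<Rightarrow> 'i list \<Rightarrow> 'k" where
  "plane_sum G w = (\<Sum>t | postorder t = rev w. G t)"

lemma postorder_eq_Nil: "postorder t = [] \<longleftrightarrow> t = Leaf"
  by (cases t) simp_all

text \<open>In the reversed word the root is followed by the right subtree, so the split position
  \<open>i\<close> is the size of \<open>r\<close>.\<close>

lemma trees_postorder_Cons:
  "{t. postorder t = rev (c # w)} = (\<lambda>(i, r, l). Node l c r) `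
    (SIGMA i:{..length w}. {t. postorder t = rev (take i w)} \<times> {t. postorder t = rev (drop i w)})"
proof (intro equalityI subsetI)
  fix t assume "t \<in> {t. postorder t = rev (c # w)}"
  then obtain l r where t: "t = Node l c r" "postorder l @ postorder r = rev w"
    by (cases t) auto
  have w: "w = rev (postorder r) @ rev (postorder l)"
    by (metis rev_append rev_rev_ident t(2))
  have "t = (\<lambda>(i, r, l). Node l c r) (size r, r, l)"
    using t by simp
  moreover have "(size r, r, l) \<in> (SIGMA i:{..length w}. {t. postorder t = rev (take i w)} \<times> {t. postorder t = rev (drop i w)})"
    by (simp add: w)
  ultimately show "t \<in> (\<lambda>(i, r, l). Node l c r) `
    (SIGMA i:{..length w}. {t. postorder t = rev (take i w)} \<times> {t. postorder t = rev (drop i w)})"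
    by blast
qed (auto simp flip: rev_append)

lemma finite_trees_postorder: "finite {t. postorder t = rev w}"
proof (induction w rule: length_induct)
  case (1 w)
  show ?case
  proof (cases w)
    case (Cons c v)
    show ?thesis
      unfolding Cons trees_postorder_Cons
      using 1 Cons by (intro finite_imageI finite_SigmaI) auto
  qed (simp add: postorder_eq_Nil)
qed

lemma plane_sum_Cons:
  fixes w :: "'i list"
  shows
  "plane_sum G (c # w) = (\<Sum>i\<le>length w. \<Sum>r | postorder r = rev (take i w).
     \<Sum>l | postorder l = rev (drop i w). G (Node l c r))"
proof -
  let ?T = "\<lambda>w. {t. postorder t = rev w}"
  have "inj_on (\<lambda>(i, r, l). Node l c r) (SIGMA i:{..length w}. ?T (take i w) \<times> ?T (drop i w))"
    by (auto simp: inj_on_def) (metis length_take min.absorb2)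
  then have "plane_sum G (c # w) =
      (\<Sum>(i, r, l)\<in>(SIGMA i:{..length w}. ?T (take i w) \<times> ?T (drop i w)). G (Node l c r))"
    unfolding plane_sum_def trees_postorder_Cons
    by (simp add: sum.reindex case_prod_unfold)
  then show ?thesis
    by (simp add: sum.Sigma finite_trees_postorder case_prod_unfold)
qed

lemma tree_sum_plane: "tree_sum (plane_sum :: ('i tree \<Rightarrow> 'k::comm_ring_1) \<Rightarrow> _) deconc"
proof
  fix x :: 'k and w :: "'i list"
  have "postorder t \<noteq> rev w" if "w \<noteq> []" "t = Leaf" for t
    using that by auto
  then show "plane_sum (\<lambda>t. if t = Leaf then x else 0) w = unit_at_nil x w"
    by (auto simp: plane_sum_def postorder_eq_Nil intro!: sum.neutral)
next
  fix G L R :: "'i tree \<Rightarrow> 'k" and c and w :: "'i list"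
  assume "\<And>l r. G (Node l c r) = L l * R r"
  then have "G (Node l c r) = R r * L l" for l r
    by (simp add: mult.commute)
  then show "plane_sum G (c # w) = deconc (plane_sum R) (plane_sum L) w"
    unfolding plane_sum_Cons deconc_sum by (simp add: plane_sum_def sum_product)
next
  fix G H :: "'i tree \<Rightarrow> 'k" and c and w :: "'i list"
  assume "\<And>l r. G (Node l c r) = H (Node l c r)"
  then show "plane_sum G (c # w) = plane_sum H (c # w)"
    by (simp add: plane_sum_Cons)
qed (simp_all add: plane_sum_def postorder_eq_Nil sum.distrib deconc_unit_at_nil
      deconc_unit_at_nil_right)

section \<open>Decreasing trees\<close>

text \<open>Arbitrary label sets are allowed because the two subtrees of a root carry complementary
  sets of the remaining labels.\<close>

definition decreasing_trees :: "nat set \<Rightarrow> nat tree set" where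
  "decreasing_trees A = {L. distinct (inorder L) \<and> set_tree L = A \<and> decreasing L}"

definition decreasing_sum :: "('i tree \<Rightarrow> 'k::comm_ring_1) \<Rightarrow> 'i list \<Rightarrow> 'k" where
  "decreasing_sum G w = (\<Sum>L\<in>decreasing_trees {..<length w}. G (map_tree ((!) (rev w)) L))"

lemma decreasing_trees_empty [simp]: "decreasing_trees {} = {Leaf}"
  by (auto simp: decreasing_trees_def)

lemma decreasing_map_tree:
  "strict_mono_on (set_tree L) h \<Longrightarrow> decreasing L \<Longrightarrow> decreasing (map_tree h L)"
  by (induction L) (auto simp: tree.set_map strict_mono_on_def)

lemma map_tree_in_decreasing_trees:
  assumes "strict_mono_on A h" "L \<in> decreasing_trees A"
  shows "map_tree h L \<in> decreasing_trees (h ` A)"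
  using assms strict_mono_on_imp_inj_on[OF assms(1)]
  by (auto simp: decreasing_trees_def inorder_map distinct_map decreasing_map_tree tree.set_map)

text \<open>Standardization: the increasing bijection \<open>h\<close> onto \<open>A\<close>
  preserves decreasing labelings, and the color of the label \<open>h j\<close> is the letter of
  \<open>subword xs A\<close> at position \<open>j\<close>.\<close>

lemma decreasing_sum_relabel:
  assumes "finite A"
  shows "(\<Sum>L\<in>decreasing_trees A. G (map_tree ((!) xs) L)) = decreasing_sum G (rev (subword xs A))"
proof -
  define h where "h = (!) (sorted_list_of_set A)"
  define h' where "h' = the_inv_into {..<card A} h"
  have h: "strict_mono_on {..<card A} h" "h ` {..<card A} = A"
    using strict_mono_on_enum[OF assms] image_enum[OF assms] by (simp_all add: h_def)
  have inj: "inj_on h {..<card A}"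
    using h(1) by (rule strict_mono_on_imp_inj_on)
  have h'h: "h' (h j) = j" if "j < card A" for j
    using that inj by (simp add: h'_def the_inv_into_f_f)
  have hh': "h (h' x) = x" "h' x < card A" if x: "x \<in> A" for x
  proof -
    obtain j where "j < card A" "x = h j" using x h(2) by blast
    then show "h (h' x) = x" "h' x < card A" using h'h by simp_all
  qed
  have h': "strict_mono_on A h'" "h' ` A = {..<card A}"
  proof -
    show "strict_mono_on A h'"
    proof (rule strict_mono_onI, rule ccontr)
      fix x y assume xy: "x \<in> A" "y \<in> A" "x < y" and "\<not> h' x < h' y"
      then consider "h' x = h' y" | "h' y < h' x" by linarith
      then show False
      proof cases
        case 1
        then show False using xy hh'(1) by (metis less_irrefl)
      next
        case 2
        then have "h (h' y) < h (h' x)"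
          using strict_mono_onD[OF h(1)] xy hh'(2) by simp
        then show False using xy hh'(1) by simp
      qed
    qed
    have "h' ` h ` {..<card A} = {..<card A}"
      using h'h by (simp add: image_image)
    then show "h' ` A = {..<card A}"
      by (simp only: h(2))
  qed
  have col: "subword xs A ! h' x = xs ! x" if "x \<in> A" for x
    using hh'[OF that] assms by (simp add: h_def subword_def)
  show ?thesis
    unfolding decreasing_sum_def
  proof (rule sum.reindex_bij_witness[where i = "map_tree h" and j = "map_tree h'"])
    fix L assume L: "L \<in> decreasing_trees A"
    then have S: "set_tree L = A" by (simp add: decreasing_trees_def)
    show "map_tree h (map_tree h' L) = L"
      using S hh' by (auto simp: tree.map_comp intro!: tree.map_ident_strong)
    show "map_tree h' L \<in> decreasing_trees {..<length (rev (subword xs A))}"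
      using map_tree_in_decreasing_trees[OF h'(1) L] h'(2) by simp
    show "G (map_tree ((!) (rev (rev (subword xs A)))) (map_tree h' L)) = G (map_tree ((!) xs) L)"
      using S col by (auto simp: tree.map_comp intro!: arg_cong[of _ _ G] tree.map_cong0)
  next
    fix L assume "L \<in> decreasing_trees {..<length (rev (subword xs A))}"
    then have L: "L \<in> decreasing_trees {..<card A}" by simp
    then have S: "set_tree L = {..<card A}" by (simp add: decreasing_trees_def)
    show "map_tree h' (map_tree h L) = L"
      using S h'h by (auto simp: tree.map_comp intro!: tree.map_ident_strong)
    show "map_tree h L \<in> decreasing_trees A"
      using map_tree_in_decreasing_trees[OF h(1) L] h(2) by simp
  qed
qed

text \<open>The largest label must sit at the root, and the others are distributed freely;
  \<open>U\<close> is the label set of the right subtree.\<close>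

lemma decreasing_trees_insert:
  assumes "\<And>x. x \<in> A \<Longrightarrow> x < n"
  shows "decreasing_trees (insert n A) = (\<lambda>(U, r, l). Node l n r) `
    (SIGMA U:Pow A. decreasing_trees U \<times> decreasing_trees (A - U))"
proof (intro equalityI subsetI)
  fix L assume L: "L \<in> decreasing_trees (insert n A)"
  then obtain l x r where Lx: "L = Node l x r"
    by (cases L) (auto simp: decreasing_trees_def)
  have x: "x = n"
  proof (rule ccontr)
    assume "x \<noteq> n"
    moreover have "n \<in> set_tree L" "x \<in> insert n A" using L Lx by (auto simp: decreasing_trees_def)
    ultimately have "x < n" "n < x" using L assms Lx by (auto simp: decreasing_trees_def)
    then show False by simp
  qed
  have "n \<notin> A" using assms by blast
  moreover have "n \<notin> set_tree l" "n \<notin> set_tree r" "set_tree l \<inter> set_tree r = {}"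
    "insert n (set_tree l \<union> set_tree r) = insert n A"
    using L unfolding Lx x by (auto simp: decreasing_trees_def)
  ultimately have A: "set_tree l \<union> set_tree r = A" and "set_tree l \<inter> set_tree r = {}"
    using insert_ident[of n "set_tree l \<union> set_tree r" A] by simp_all
  then have "set_tree l = A - set_tree r" "set_tree r \<subseteq> A"
    by auto
  then have "(set_tree r, r, l) \<in> (SIGMA U:Pow A. decreasing_trees U \<times> decreasing_trees (A - U))"
    using L by (auto simp: Lx decreasing_trees_def)
  then show "L \<in> (\<lambda>(U, r, l). Node l n r) ` (SIGMA U:Pow A. decreasing_trees U \<times> decreasing_trees (A - U))"
    unfolding Lx x by (rule rev_image_eqI) simp
next
  fix L assume "L \<in> (\<lambda>(U, r, l). Node l n r) ` (SIGMA U:Pow A. decreasing_trees U \<times> decreasing_trees (A - U))"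
  then obtain U l r where L: "L = Node l n r" "U \<subseteq> A" "set_tree r = U" "set_tree l = A - U"
      "distinct (inorder l)" "distinct (inorder r)" "decreasing l" "decreasing r"
    by (auto simp: decreasing_trees_def)
  have "n \<notin> A" using assms by blast
  then show "L \<in> decreasing_trees (insert n A)"
    using L assms by (auto simp: decreasing_trees_def)
qed

lemma finite_decreasing_trees: "finite A \<Longrightarrow> finite (decreasing_trees A)"
proof (induction "card A" arbitrary: A rule: less_induct)
  case less
  show ?case
  proof (cases "A = {}")
    case False
    let ?n = "Max A" and ?B = "A - {Max A}"
    have A: "A = insert ?n ?B" using less.prems False by (simp add: insert_absorb)
    have "finite (decreasing_trees U)" if "U \<subseteq> ?B" for U
    proof (rule less.hyps)
      show "card U < card A"
        using that less.prems False Max_in[of A] by (intro psubset_card_mono) blast+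
    qed (use that less.prems finite_subset in blast)
    moreover have "x < ?n" if "x \<in> ?B" for x
      using that less.prems by (simp add: order_le_neq_trans)
    ultimately show ?thesis
      using less.prems by (subst A, subst decreasing_trees_insert) (auto intro!: finite_imageI finite_SigmaI)
  qed simp
qed

lemma decreasing_sum_snoc:
  fixes G :: "'i tree \<Rightarrow> 'k::comm_ring_1"
  shows "decreasing_sum G (rev (xs @ [c])) = (\<Sum>U\<in>Pow {..<length xs}.
    \<Sum>r\<in>decreasing_trees U. \<Sum>l\<in>decreasing_trees ({..<length xs} - U).
      G (Node (map_tree ((!) xs) l) c (map_tree ((!) xs) r)))"
proof -
  let ?n = "length xs" and ?D = decreasing_trees
  let ?S = "SIGMA U:Pow {..<?n}. ?D U \<times> ?D ({..<?n} - U)"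
  have "inj_on (\<lambda>(U, r, l). Node l ?n r) ?S"
    by (auto simp: inj_on_def decreasing_trees_def)
  then have "decreasing_sum G (rev (xs @ [c])) =
      (\<Sum>(U, r, l)\<in>?S. G (map_tree ((!) (xs @ [c])) (Node l ?n r)))"
    unfolding decreasing_sum_def length_rev length_append_singleton lessThan_Suc rev_rev_ident
    by (subst decreasing_trees_insert) (simp_all add: sum.reindex case_prod_unfold)
  also have "\<dots> = (\<Sum>(U, r, l)\<in>?S. G (Node (map_tree ((!) xs) l) c (map_tree ((!) xs) r)))"
  proof (rule sum.cong[OF refl], clarify)
    fix U l r assume "U \<subseteq> {..<?n}" "r \<in> ?D U" "l \<in> ?D ({..<?n} - U)"
    then have "map_tree ((!) (xs @ [c])) l = map_tree ((!) xs) l" "map_tree ((!) (xs @ [c])) r = map_tree ((!) xs) r"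
      by (auto simp: decreasing_trees_def nth_append intro!: tree.map_cong0)
    then show "G (map_tree ((!) (xs @ [c])) (Node l ?n r)) = G (Node (map_tree ((!) xs) l) c (map_tree ((!) xs) r))"
      by simp
  qed
  finally have *: "decreasing_sum G (rev (xs @ [c])) = \<dots>" .
  have "finite (?D U)" if "U \<subseteq> {..<?n}" for U
    using that by (intro finite_decreasing_trees) (rule finite_subset, simp, simp)
  then show ?thesis
    unfolding * by (subst sum.Sigma[symmetric]) (simp_all add: sum.cartesian_product)
qed

lemma tree_sum_decreasing: "tree_sum (decreasing_sum :: ('i tree \<Rightarrow> 'k::comm_ring_1) \<Rightarrow> _) shuf"
proof
  fix x :: 'k and w :: "'i list"
  show "decreasing_sum (\<lambda>t. if t = Leaf then x else 0) w = unit_at_nil x w"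
  proof (cases "w = []")
    case False
    have "L \<noteq> Leaf" if "L \<in> decreasing_trees {..<length w}" for L
    proof -
      have "0 \<in> set_tree L" using that False by (simp add: decreasing_trees_def)
      then show ?thesis by auto
    qed
    then show ?thesis
      using False unfolding decreasing_sum_def by (subst sum.neutral) auto
  qed (simp add: decreasing_sum_def)
next
  fix G L R :: "'i tree \<Rightarrow> 'k" and c and w :: "'i list"
  assume "\<And>l r. G (Node l c r) = L l * R r"
  then have G: "G (Node l c r) = R r * L l" for l r
    by (simp add: mult.commute)
  define xs where "xs = rev w"
  have "decreasing_sum G (rev (xs @ [c])) = (\<Sum>U\<in>Pow {..<length xs}.
      (\<Sum>r\<in>decreasing_trees U. R (map_tree ((!) xs) r)) *
      (\<Sum>l\<in>decreasing_trees ({..<length xs} - U). L (map_tree ((!) xs) l)))"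
    unfolding decreasing_sum_snoc by (simp add: G sum_product)
  \<comment> \<open>Standardizing each subtree on its own label set matches the subset form of
    \<open>shuf\<close>.\<close>
  also have "\<dots> = shuf (decreasing_sum R) (decreasing_sum L) (rev xs)"
    unfolding shuf_sum
  proof (rule sum.cong[OF refl])
    fix U assume "U \<in> Pow {..<length xs}"
    then have "finite U" "finite ({..<length xs} - U)"
      by (auto intro: finite_subset)
    then show "(\<Sum>r\<in>decreasing_trees U. R (map_tree ((!) xs) r)) *
        (\<Sum>l\<in>decreasing_trees ({..<length xs} - U). L (map_tree ((!) xs) l)) =
      decreasing_sum R (rev (subword xs U)) * decreasing_sum L (rev (subword xs ({..<length xs} - U)))"
      by (simp only: decreasing_sum_relabel)
  qed
  finally show "decreasing_sum G (c # w) = shuf (decreasing_sum R) (decreasing_sum L) w"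
    by (simp add: xs_def)
next
  fix G H :: "'i tree \<Rightarrow> 'k" and c and w :: "'i list"
  assume "\<And>l r. G (Node l c r) = H (Node l c r)"
  then show "decreasing_sum G (c # w) = decreasing_sum H (c # w)"
    by (simp add: decreasing_sum_snoc[of _ "rev w" c, simplified])
next
  fix f :: "'i list \<Rightarrow> 'k" and x w
  show "shuf f (unit_at_nil x) w = f w * x"
    by (subst shuf_commute) (simp add: shuf_unit_at_nil mult.commute)
qed (simp_all add: decreasing_sum_def sum.distrib shuf_unit_at_nil)

subsection \<open>Moment-cumulant recursions\<close>

text \<open>Nonempty subsets are sorted by their maximum \<open>p\<close>.\<close>

lemma sum_Pow_lessThan:
  fixes n :: nat
  shows "(\<Sum>U\<in>Pow {..<n}. f U) = f {} + (\<Sum>p<n. \<Sum>U\<in>Pow {..<p}. f (insert p U))"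
  by (induction n) (simp_all add: lessThan_Suc[of n for n] sum_Pow_insert ac_simps)

lemma subword_take: "U \<subseteq> {..<p} \<Longrightarrow> p \<le> length xs \<Longrightarrow> subword (take p xs) U = subword xs U"
  using subword_append[of U "take p xs" "drop p xs"] by simp

lemma subword_interval: "n \<le> length xs \<Longrightarrow> subword xs {i..<n} = drop i (take n xs)"
  by (auto simp: subword_def intro: nth_equalityI)

lemma block_prod_subword: "block_prod C xs P = (\<Prod>U\<in>P. C (subword xs U))"
  by (simp add: block_prod_def subword_def)

lemma block_prod_append:
  assumes "\<And>U. U \<in> P \<Longrightarrow> U \<subseteq> {..<length xs}"
  shows "block_prod C (xs @ ys) P = block_prod C xs P"
  unfolding block_prod_subword using assms by (intro prod.cong) (simp_all add: subword_append)

lemma partition_on_subset: "partition_on A P \<Longrightarrow> U \<in> P \<Longrightarrow> U \<subseteq> A"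
  by (auto simp: partition_on_def)

lemma partition_on_image:
  assumes "partition_on A P" "inj_on h A"
  shows "partition_on (h ` A) ((`) h ` P)"
proof -
  have "(`) h ` P - {{}} = (`) h ` P"
    using partition_onD3[OF assms(1)] by auto
  then show ?thesis
    using partition_on_inj_image[OF assms] by simp
qed

text \<open>Standardization for partitions; \<open>Q\<close> is a property that increasing
  relabelling preserves, such as being noncrossing.\<close>

lemma sum_partitions_enum:
  fixes A :: "nat set" and C :: "'a list \<Rightarrow> 'k::comm_ring_1"
  defines "h \<equiv> (!) (sorted_list_of_set A)"
  assumes A: "finite A"
    and Q: "\<And>P. P \<subseteq> Pow {..<card A} \<Longrightarrow> Q ((`) h ` P) = Q P"
  shows "(\<Sum>P | partition_on A P \<and> Q P. block_prod C xs P) =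
    (\<Sum>P | partition_on {..<card A} P \<and> Q P. block_prod C (subword xs A) P)"
proof -
  define h' where "h' = the_inv_into {..<card A} h"
  have inj: "inj_on h {..<card A}" and im: "h ` {..<card A} = A"
    using strict_mono_on_imp_inj_on[OF strict_mono_on_enum[OF A]] image_enum[OF A] by (simp_all add: h_def)
  then have inj': "inj_on h' A" and im': "h' ` A = {..<card A}"
    unfolding h'_def by (metis inj_on_the_inv_into, metis the_inv_into_onto)
  have hh': "h ` h' ` U = U" if "U \<subseteq> A" for U
    using that inj im f_the_inv_into_f[OF inj] by (force simp: h'_def image_image)
  have h'h: "h' ` h ` U = U" if "U \<subseteq> {..<card A}" for U
    using that the_inv_into_f_f[OF inj] by (force simp: h'_def image_image)
  show ?thesis
  proof (rule sum.reindex_bij_witness[where i = "(`) ((`) h)" and j = "(`) ((`) h')"])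
    fix P assume "P \<in> {P. partition_on A P \<and> Q P}"
    then have P: "partition_on A P" "Q P" by auto
    have sub: "U \<subseteq> A" if "U \<in> P" for U
      using P(1) that by (rule partition_on_subset)
    show *: "(`) h ` (`) h' ` P = P"
      using sub hh' by (simp add: image_image)
    have part: "partition_on {..<card A} ((`) h' ` P)"
      using partition_on_image[OF P(1) inj'] im' by simp
    then have "(`) h' ` P \<subseteq> Pow {..<card A}"
      using partition_on_subset by blast
    then show "(`) h' ` P \<in> {P. partition_on {..<card A} P \<and> Q P}"
      using part P(2) Q[of "(`) h' ` P"] * by simp
    have "inj_on ((`) h') P"
      by (rule inj_on_inverseI[of _ "(`) h"]) (simp add: hh' sub)
    moreover have "subword (subword xs A) (h' ` U) = subword xs U" if "U \<in> P" for U
    proof -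
      have "h' ` U \<subseteq> {..<card A}"
        using sub[OF that] im' by blast
      then show ?thesis
        using subword_enum[OF A, of "h' ` U" xs] hh'[OF sub[OF that]] by (simp add: h_def)
    qed
    ultimately show "block_prod C (subword xs A) ((`) h' ` P) = block_prod C xs P"
      by (simp add: block_prod_subword prod.reindex)
  next
    fix P assume "P \<in> {P. partition_on {..<card A} P \<and> Q P}"
    then have P: "partition_on {..<card A} P" "Q P" by auto
    then have sub: "P \<subseteq> Pow {..<card A}"
      using partition_on_subset by blast
    show "(`) h' ` (`) h ` P = P"
      using partition_on_subset[OF P(1)] h'h by (simp add: image_image)
    show "(`) h ` P \<in> {P. partition_on A P \<and> Q P}"
      using partition_on_image[OF P(1) inj] im P(2) Q[OF sub] by simp
  qed
qed

text \<open>A partition is determined by the block \<open>insert n U\<close> of the new point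
  together with its other blocks.\<close>

lemma partition_on_insert_point:
  assumes "n \<notin> A"
  shows "{P. partition_on (insert n A) P} =
    (\<lambda>(U, P). insert (insert n U) P) ` (SIGMA U:Pow A. {P. partition_on (A - U) P})"
proof (intro equalityI subsetI)
  fix P assume "P \<in> {P. partition_on (insert n A) P}"
  then have P: "partition_on (insert n A) P" by simp
  then obtain V where V: "V \<in> P" "n \<in> V"
    by (auto simp: partition_on_def)
  define U where "U = V - {n}"
  have "V = insert n U" "U \<subseteq> A"
    using V partition_on_subset[OF P] by (auto simp: U_def)
  moreover have "P = insert V (P - {V})" "disjnt V (\<Union>(P - {V}))"
    using V P by (auto simp: partition_on_def disjnt_def disjoint_def)
  then have "partition_on (insert n A - V) (P - {V})"
    using P partition_on_insert[of V "P - {V}" "insert n A"] by simp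
  moreover have "insert n A - insert n U = A - U"
    using assms by auto
  ultimately show "P \<in> (\<lambda>(U, P). insert (insert n U) P) ` (SIGMA U:Pow A. {P. partition_on (A - U) P})"
    using \<open>P = insert V (P - {V})\<close> by (intro image_eqI[where x = "(U, P - {V})"]) auto
next
  fix P assume "P \<in> (\<lambda>(U, P). insert (insert n U) P) ` (SIGMA U:Pow A. {P. partition_on (A - U) P})"
  then obtain U P' where P: "P = insert (insert n U) P'" "U \<subseteq> A" "partition_on (A - U) P'"
    by auto
  have "disjnt (insert n U) (\<Union>P')"
    using P(3) assms by (auto simp: partition_on_def disjnt_def)
  moreover have "insert n A - insert n U = A - U"
    using assms by auto
  ultimately show "P \<in> {P. partition_on (insert n A) P}"
    using P by (auto simp: partition_on_insert)
qed

lemma inj_on_insert_point: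
  assumes "n \<notin> A"
  shows "inj_on (\<lambda>(U, P). insert (insert n U) P) (SIGMA U:Pow A. {P. partition_on (A - U) P})"
proof (rule inj_onI, clarify)
  fix U P U' P'
  assume *: "U \<subseteq> A" "U' \<subseteq> A" "partition_on (A - U) P" "partition_on (A - U') P'"
    "insert (insert n U) P = insert (insert n U') P'"
  have n: "n \<notin> U" "n \<notin> U'" "\<And>V. V \<in> P \<Longrightarrow> n \<notin> V" "\<And>V. V \<in> P' \<Longrightarrow> n \<notin> V"
    using * assms by (auto simp: partition_on_def)
  then have "insert n U \<notin> P" "insert n U' \<notin> P'" by auto
  moreover have "insert n U = insert n U'"
    using *(5) n by (metis insertCI insertE)
  ultimately show "U = U' \<and> P = P'"
    using *(5) n by (metis insert_ident)
qed

lemma sum_partitions_insert: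
  fixes F :: "'a set set \<Rightarrow> 'k::comm_ring_1"
  assumes "finite A" "n \<notin> A"
  shows "(\<Sum>P | partition_on (insert n A) P \<and> Q P. F P) =
    (\<Sum>U\<in>Pow A. \<Sum>P | partition_on (A - U) P \<and> Q (insert (insert n U) P). F (insert (insert n U) P))"
proof -
  \<comment> \<open>Moving the side condition into the summand lets the bijection be applied to all
    partitions at once.\<close>
  let ?F = "\<lambda>P. if Q P then F P else 0"
  have fin: "finite {P. partition_on B P}" if "B \<subseteq> insert n A" for B
    using assms(1) that by (meson finite.insertI finitely_many_partition_on finite_subset)
  have filter: "(\<Sum>P | partition_on B P \<and> R P. G P) = (\<Sum>P | partition_on B P. if R P then G P else 0)"
    if "B \<subseteq> insert n A" for B R and G :: "'a set set \<Rightarrow> 'k"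
    using sum.inter_filter[OF fin[OF that], of G R] by simp
  have "(\<Sum>P | partition_on (insert n A) P \<and> Q P. F P) = (\<Sum>P | partition_on (insert n A) P. ?F P)"
    by (rule filter) simp
  also have "\<dots> = (\<Sum>(U, P)\<in>(SIGMA U:Pow A. {P. partition_on (A - U) P}). ?F (insert (insert n U) P))"
    unfolding partition_on_insert_point[OF assms(2)]
    by (subst sum.reindex[OF inj_on_insert_point[OF assms(2)]]) (simp add: case_prod_unfold)
  also have "\<dots> = (\<Sum>U\<in>Pow A. \<Sum>P | partition_on (A - U) P. ?F (insert (insert n U) P))"
    using assms(1) by (subst sum.Sigma) (auto intro: fin)
  also have "\<dots> = (\<Sum>U\<in>Pow A. \<Sum>P | partition_on (A - U) P \<and> Q (insert (insert n U) P). F (insert (insert n U) P))"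
    by (intro sum.cong[OF refl] filter[symmetric]) auto
  finally show ?thesis .
qed

lemma block_prod_insert_last:
  assumes "U \<subseteq> {..<length xs}" "partition_on ({..<length xs} - U) P"
  shows "block_prod C (xs @ [d]) (insert (insert (length xs) U) P) = C (subword xs U @ [d]) * block_prod C xs P"
proof -
  have sub: "V \<subseteq> {..<length xs}" if "V \<in> P" for V
    using partition_on_subset[OF assms(2) that] by blast
  have "insert (length xs) U \<notin> P"
    using sub by blast
  moreover have "finite P"
    using assms(2) by (rule finite_elements[rotated]) simp
  moreover have "block_prod C (xs @ [d]) P = block_prod C xs P"
    using sub by (rule block_prod_append)
  ultimately show ?thesis
    using assms(1) by (simp add: block_prod_subword subword_insert_length)
qed

text \<open>The common start of the three recursions: the block of the last point supplies the
  cumulant factor, and only the condition \<open>Q\<close> on the rest differs.\<close>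

lemma sum_partitions_snoc:
  "(\<Sum>P | partition_on {..<length (xs @ [d])} P \<and> Q P. block_prod C (xs @ [d]) P) =
    (\<Sum>U\<in>Pow {..<length xs}. C (subword xs U @ [d]) *
      (\<Sum>P | partition_on ({..<length xs} - U) P \<and> Q (insert (insert (length xs) U) P). block_prod C xs P))"
proof -
  have "(\<Sum>P | partition_on {..<length (xs @ [d])} P \<and> Q P. block_prod C (xs @ [d]) P) =
    (\<Sum>U\<in>Pow {..<length xs}. \<Sum>P | partition_on ({..<length xs} - U) P \<and>
      Q (insert (insert (length xs) U) P). block_prod C (xs @ [d]) (insert (insert (length xs) U) P))"
    using sum_partitions_insert[where A = "{..<length xs}" and n = "length xs" and Q = Q and F = "block_prod C (xs @ [d])"]
    by (simp add: lessThan_Suc)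
  also have "\<dots> = (\<Sum>U\<in>Pow {..<length xs}. C (subword xs U @ [d]) *
      (\<Sum>P | partition_on ({..<length xs} - U) P \<and> Q (insert (insert (length xs) U) P). block_prod C xs P))"
    unfolding sum_distrib_left by (intro sum.cong refl) (simp add: block_prod_insert_last)
  finally show ?thesis .
qed

section \<open>The classical and the Boolean recursion\<close>

text \<open>No condition ties the other blocks to the last one, so standardizing the partitions of
  the complement yields a moment.\<close>

lemma classical_moments_snoc:
  assumes M: "\<And>xs. M xs = (\<Sum>P\<in>set_partitions (length xs). block_prod C xs P)"
  shows "M (xs @ [d]) = (\<Sum>U\<in>Pow {..<length xs}. C (subword xs U @ [d]) * M (subword xs ({..<length xs} - U)))"
proof -
  have "M (xs @ [d]) = (\<Sum>U\<in>Pow {..<length xs}. C (subword xs U @ [d]) *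
      (\<Sum>P | partition_on ({..<length xs} - U) P \<and> True. block_prod C xs P))"
    using sum_partitions_snoc[where Q = "\<lambda>_. True"] by (simp add: M set_partitions_def)
  also have "\<dots> = (\<Sum>U\<in>Pow {..<length xs}. C (subword xs U @ [d]) * M (subword xs ({..<length xs} - U)))"
    by (subst sum_partitions_enum) (simp_all add: M set_partitions_def)
  finally show ?thesis .
qed

text \<open>Convexity and the presence of \<open>n\<close> make \<open>U\<close> upward closed below
  \<open>n\<close>; an empty \<open>U\<close> corresponds to \<open>i = n\<close>.\<close>

lemma interval_partition_last_block:
  assumes "U \<subseteq> {..<n}" "interval_partition (insert (insert n U) P)"
  obtains i where "i \<le> n" "U = {i..<n}"
proof (cases "U = {}")
  case True
  then show ?thesis by (intro that[of n]) simp_all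
next
  case False
  define i where "i = Min U"
  have fin: "finite U" using assms(1) finite_subset by blast
  then have "i \<in> U" "\<And>x. x \<in> U \<Longrightarrow> i \<le> x"
    using False by (simp_all add: i_def)
  moreover have "y \<in> U" if "i \<le> y" "y < n" for y
  proof -
    have "\<forall>x y z. x \<in> insert n U \<longrightarrow> z \<in> insert n U \<longrightarrow> x \<le> y \<longrightarrow> y \<le> z \<longrightarrow> y \<in> insert n U"
      using assms(2) unfolding interval_partition_def by simp
    then have "y \<in> insert n U"
      using \<open>i \<in> U\<close> that by (meson insertI1 insertI2 less_imp_le)
    then show ?thesis
      using that by simp
  qed
  ultimately show ?thesis
    using assms(1) by (intro that[of i]) auto
qed

lemma interval_partition_insert_last:
  "interval_partition (insert (insert n {i..<n}) P) \<longleftrightarrow> interval_partition P"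
proof -
  have "y \<in> insert n {i..<n}" if "x \<in> insert n {i..<n}" "z \<in> insert n {i..<n}" "x \<le> y" "y \<le> z" for x y z
    using that by auto
  then show ?thesis
    unfolding interval_partition_def ball_simps by blast
qed

lemma boolean_moments_snoc:
  assumes M: "\<And>xs. M xs = (\<Sum>P\<in>int_partitions (length xs). block_prod C xs P)"
  shows "M (xs @ [d]) = (\<Sum>i\<le>length xs. C (drop i xs @ [d]) * M (take i xs))"
proof -
  let ?n = "length xs"
  let ?S = "\<lambda>U. \<Sum>P | partition_on ({..<?n} - U) P \<and>
    interval_partition (insert (insert ?n U) P). block_prod C xs P"
  have inj: "inj_on (\<lambda>i. {i..<?n}) {..?n}"
  proof (rule inj_onI)
    fix i j assume "i \<in> {..?n}" "j \<in> {..?n}" "{i..<?n} = {j..<?n}"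
    then show "i = j"
      by (metis atLeastLessThan_eq_iff atLeastLessThan_empty_iff atMost_iff le_neq_implies_less not_less)
  qed
  have S: "?S {i..<?n} = M (take i xs)" if "i \<le> ?n" for i
  proof -
    have eq: "{..<?n} - {i..<?n} = {..<i}" using that by auto
    have "?S {i..<?n} = (\<Sum>P | partition_on {..<i} P \<and> interval_partition P. block_prod C (take i xs @ drop i xs) P)"
      unfolding interval_partition_insert_last eq by simp
    also have "\<dots> = (\<Sum>P | partition_on {..<i} P \<and> interval_partition P. block_prod C (take i xs) P)"
      using that by (intro sum.cong refl block_prod_append) (auto dest: partition_on_subset)
    also have "\<dots> = M (take i xs)"
      using that by (simp add: M int_partitions_def set_partitions_def min_absorb2)
    finally show ?thesis .
  qed
  have "M (xs @ [d]) = (\<Sum>U\<in>Pow {..<?n}. C (subword xs U @ [d]) * ?S U)"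
    using sum_partitions_snoc[where Q = interval_partition]
    by (simp add: M int_partitions_def set_partitions_def)
  also have "\<dots> = (\<Sum>U\<in>(\<lambda>i. {i..<?n}) ` {..?n}. C (subword xs U @ [d]) * ?S U)"
  \<comment> \<open>If \<open>U\<close> is not a final segment, its inner sum runs over no partition
    at all.\<close>
  proof (rule sum.mono_neutral_right)
    show "\<forall>U\<in>Pow {..<?n} - (\<lambda>i. {i..<?n}) ` {..?n}. C (subword xs U @ [d]) * ?S U = 0"
    proof
      fix U assume U: "U \<in> Pow {..<?n} - (\<lambda>i. {i..<?n}) ` {..?n}"
      then have "\<not> interval_partition (insert (insert ?n U) P)" for P
        using interval_partition_last_block[of U ?n P] by blast
      then show "C (subword xs U @ [d]) * ?S U = 0" by simp
    qed
  qed auto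
  also have "\<dots> = (\<Sum>i\<le>?n. C (subword xs {i..<?n} @ [d]) * ?S {i..<?n})"
    by (subst sum.reindex[OF inj]) simp
  also have "\<dots> = (\<Sum>i\<le>?n. C (drop i xs @ [d]) * M (take i xs))"
    by (intro sum.cong refl) (simp add: S subword_interval)
  finally show ?thesis .
qed

section \<open>The free recursion\<close>

text \<open>The relation is not symmetric: \<open>U\<close> owns the leftmost of the four
  points.\<close>

definition crossing :: "nat set \<Rightarrow> nat set \<Rightarrow> bool" where
  "crossing U V \<longleftrightarrow> (\<exists>a b c d. a < b \<and> b < c \<and> c < d \<and> a \<in> U \<and> c \<in> U \<and> b \<in> V \<and> d \<in> V)"

lemma noncrossing_iff:
  "noncrossing P \<longleftrightarrow> (\<forall>U\<in>P. \<forall>V\<in>P. U \<noteq> V \<longrightarrow> \<not> crossing U V)"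
  unfolding noncrossing_def crossing_def[symmetric] by blast

lemma crossing_mono: "crossing U V \<Longrightarrow> U \<subseteq> U' \<Longrightarrow> V \<subseteq> V' \<Longrightarrow> crossing U' V'"
  unfolding crossing_def by blast

lemma noncrossing_insert:
  assumes "B \<notin> P"
  shows "noncrossing (insert B P) \<longleftrightarrow> noncrossing P \<and> (\<forall>V\<in>P. \<not> crossing B V \<and> \<not> crossing V B)"
  using assms unfolding noncrossing_iff by auto

lemma crossing_image_iff:
  assumes "strict_mono_on A h" "U \<subseteq> A" "V \<subseteq> A"
  shows "crossing (h ` U) (h ` V) \<longleftrightarrow> crossing U V"
proof -
  have less: "h x < h y \<longleftrightarrow> x < y" if "x \<in> A" "y \<in> A" for x y
    using strict_mono_on_less[OF assms(1)] that by simp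
  have "(\<exists>a\<in>U. \<exists>b\<in>V. \<exists>c\<in>U. \<exists>d\<in>V. h a < h b \<and> h b < h c \<and> h c < h d) \<longleftrightarrow>
      (\<exists>a\<in>U. \<exists>b\<in>V. \<exists>c\<in>U. \<exists>d\<in>V. a < b \<and> b < c \<and> c < d)"
    using assms(2,3) by (intro bex_cong refl) (simp add: less subset_iff)
  then show ?thesis
    unfolding crossing_def by blast
qed

lemma noncrossing_image_iff:
  assumes "strict_mono_on A h" "P \<subseteq> Pow A"
  shows "noncrossing ((`) h ` P) \<longleftrightarrow> noncrossing P"
proof -
  have "h ` U = h ` V \<longleftrightarrow> U = V" "crossing (h ` U) (h ` V) \<longleftrightarrow> crossing U V" if "U \<in> P" "V \<in> P" for U V
  proof -
    have "U \<subseteq> A" "V \<subseteq> A" using that assms(2) by blast+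
    then show "h ` U = h ` V \<longleftrightarrow> U = V" "crossing (h ` U) (h ` V) \<longleftrightarrow> crossing U V"
      using inj_on_image_eq_iff[OF strict_mono_on_imp_inj_on[OF assms(1)]]
        crossing_image_iff[OF assms(1)] by simp_all
  qed
  then show ?thesis
    unfolding noncrossing_iff by auto
qed

lemma crossing_singleton: "\<not> crossing {n} V" "\<not> crossing V {n}"
  by (auto simp: crossing_def)

lemma crossing_separated:
  assumes "\<And>x y. x \<in> U \<Longrightarrow> y \<in> V \<Longrightarrow> x < y"
  shows "\<not> crossing U V" "\<not> crossing V U"
proof -
  have "\<not> (b < c \<and> b \<in> V \<and> c \<in> U)" for b c
    using assms[of c b] by auto
  then show "\<not> crossing U V" "\<not> crossing V U"
    unfolding crossing_def by blast+
qed

lemma noncrossing_union_separated: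
  assumes "\<And>U V. U \<in> P \<Longrightarrow> V \<in> Q \<Longrightarrow> U \<subseteq> {..<p} \<and> V \<subseteq> {p<..<n}"
  shows "noncrossing (P \<union> Q) \<longleftrightarrow> noncrossing P \<and> noncrossing (Q :: nat set set)"
proof -
  have "\<not> crossing U V" "\<not> crossing V U" if "U \<in> P" "V \<in> Q" for U V
  proof -
    have "x < y" if "x \<in> U" "y \<in> V" for x y
      using assms[OF \<open>U \<in> P\<close> \<open>V \<in> Q\<close>] that by fastforce
    then show "\<not> crossing U V" "\<not> crossing V U"
      using crossing_separated[of U V] by blast+
  qed
  then show ?thesis
    unfolding noncrossing_iff ball_Un by auto
qed

text \<open>The block of the last point \<open>n\<close> is cut at its second largest element \<open>p\<close>.\<close>

lemma crossing_cut:
  assumes "U \<subseteq> {..<p}" "p < n"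
  shows "V \<subseteq> {..<p} \<Longrightarrow> crossing (insert n (insert p U)) V \<longleftrightarrow> crossing (insert p U) V"
    and "V \<subseteq> {..<p} \<Longrightarrow> crossing V (insert n (insert p U)) \<longleftrightarrow> crossing V (insert p U)"
    and "V \<subseteq> {p<..<n} \<Longrightarrow> \<not> crossing (insert n (insert p U)) V"
    and "V \<subseteq> {p<..<n} \<Longrightarrow> \<not> crossing V (insert n (insert p U))"
proof -
  show "crossing (insert n (insert p U)) V \<longleftrightarrow> crossing (insert p U) V" if V: "V \<subseteq> {..<p}"
  proof
    assume "crossing (insert n (insert p U)) V"
    then obtain a b c d where *: "a < b" "b < c" "c < d" "a \<in> insert n (insert p U)"
        "c \<in> insert n (insert p U)" "b \<in> V" "d \<in> V"
      unfolding crossing_def by blast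
    then have "d < p" using V by auto
    then have "a \<in> U" "c \<in> U" using * assms(2) by auto
    then show "crossing (insert p U) V"
      unfolding crossing_def using * by blast
  qed (auto elim: crossing_mono)
  show "crossing V (insert n (insert p U)) \<longleftrightarrow> crossing V (insert p U)" if V: "V \<subseteq> {..<p}"
  proof
    assume "crossing V (insert n (insert p U))"
    then obtain a b c d where *: "a < b" "b < c" "c < d" "a \<in> V" "c \<in> V"
        "b \<in> insert n (insert p U)" "d \<in> insert n (insert p U)"
      unfolding crossing_def by blast
    then have "c < p" using V by auto
    then have "b \<in> insert p U" using * assms(2) by auto
    moreover have "\<exists>d'\<in>insert p U. c < d'"
      using * \<open>c < p\<close> by auto
    ultimately show "crossing V (insert p U)"
      unfolding crossing_def using * by blast
  qed (auto elim: crossing_mono)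
  have out: "\<not> (y < x \<and> x < z)" if "V \<subseteq> {p<..<n}" "x \<in> insert n (insert p U)" "y \<in> V" "z \<in> V" for x y z
  proof -
    have "p < y" "z < n" using that by auto
    moreover have "x \<le> p \<or> x = n" using that(2) assms(1) by auto
    ultimately show ?thesis by auto
  qed
  show "\<not> crossing (insert n (insert p U)) V" if V: "V \<subseteq> {p<..<n}"
    unfolding crossing_def using out[OF V] by blast
  show "\<not> crossing V (insert n (insert p U))" if V: "V \<subseteq> {p<..<n}"
    unfolding crossing_def using out[OF V] by blast
qed

text \<open>The last block has no point strictly between \<open>p\<close> and \<open>n\<close>, so
  blocks there do not interact with it, while blocks left of \<open>p\<close> see only
  \<open>insert p U\<close>. Thus \<open>p\<close> becomes the last point of a smaller
  problem.\<close>

lemma noncrossing_cut: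
  assumes U: "U \<subseteq> {..<p}" "p < n"
    and P: "\<And>V. V \<in> P \<Longrightarrow> V \<subseteq> {..<p} - U" and Q: "\<And>V. V \<in> Q \<Longrightarrow> V \<subseteq> {p<..<n}"
  shows "noncrossing (insert (insert n (insert p U)) (P \<union> Q)) \<longleftrightarrow>
    noncrossing (insert (insert p U) P) \<and> noncrossing Q"
proof -
  have "insert n (insert p U) \<notin> P \<union> Q" "insert p U \<notin> P"
    using P[of "insert n (insert p U)"] P[of "insert p U"] Q[of "insert n (insert p U)"] by auto
  moreover have "noncrossing (P \<union> Q) \<longleftrightarrow> noncrossing P \<and> noncrossing Q"
    using P Q by (intro noncrossing_union_separated[of _ _ p n]) blast
  moreover have "(\<forall>V\<in>P \<union> Q. \<not> crossing (insert n (insert p U)) V \<and> \<not> crossing V (insert n (insert p U))) \<longleftrightarrow>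
      (\<forall>V\<in>P. \<not> crossing (insert p U) V \<and> \<not> crossing V (insert p U))"
    using P Q crossing_cut[OF U] by (metis Diff_subset UnE UnI1 subset_trans)
  ultimately show ?thesis
    by (simp add: noncrossing_insert) blast
qed

text \<open>A block with points on both sides of \<open>p\<close> would cross the last block, which
  contains \<open>p\<close> and \<open>n\<close>.\<close>

lemma noncrossing_cut_blocks:
  assumes "noncrossing (insert (insert n (insert p U)) P)" "V \<in> P"
    and "V \<subseteq> {..<n} - insert p U" "p < n"
  shows "V \<subseteq> {..<p} - U \<or> V \<subseteq> {p<..<n}"
proof (rule ccontr)
  assume *: "\<not> (V \<subseteq> {..<p} - U \<or> V \<subseteq> {p<..<n})"
  have "\<exists>y\<in>V. \<not> y < p" "\<exists>x\<in>V. \<not> p < x"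
    using * assms(3) by auto
  moreover have "p \<notin> V" using assms(3) by auto
  ultimately obtain x y where "x \<in> V" "x < p" "y \<in> V" "p < y"
    by (metis nat_neq_iff)
  moreover have "y < n" using assms(3) \<open>y \<in> V\<close> by auto
  ultimately have "crossing V (insert n (insert p U))"
    unfolding crossing_def by blast
  moreover have "V \<noteq> insert n (insert p U)"
    using \<open>p \<notin> V\<close> by blast
  ultimately show False
    using assms(1,2) unfolding noncrossing_iff by (metis insertCI)
qed

lemma partition_on_part:
  assumes "partition_on (A \<union> B) P" "A \<inter> B = {}" "\<And>V. V \<in> P \<Longrightarrow> V \<subseteq> A \<or> V \<subseteq> B"
  shows "partition_on A {V \<in> P. V \<subseteq> A}"
proof (rule partition_onI)
  have "x \<in> \<Union>{V \<in> P. V \<subseteq> A}" if "x \<in> A" for x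
  proof -
    obtain V where V: "V \<in> P" "x \<in> V"
      using \<open>x \<in> A\<close> partition_onD1[OF assms(1)] by blast
    then have "\<not> V \<subseteq> B"
      using \<open>x \<in> A\<close> assms(2) by blast
    then show ?thesis
      using V assms(3) by blast
  qed
  then show "\<Union>{V \<in> P. V \<subseteq> A} = A" by blast
  show "disjnt U V" if "U \<in> {V \<in> P. V \<subseteq> A}" "V \<in> {V \<in> P. V \<subseteq> A}" "U \<noteq> V" for U V
    using that partition_onD2[OF assms(1)] by (simp add: pairwise_def)
qed (use partition_onD3[OF assms(1)] in simp)

text \<open>The bijection sends a partition to the pair of its blocks left of \<open>p\<close> and
  its blocks between \<open>p\<close> and \<open>n\<close>; multiplicativity of \<open>F\<close>,
  meant for block products, factors the sum.\<close>

lemma sum_partitions_cut: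
  fixes F :: "nat set set \<Rightarrow> 'k::comm_ring_1"
  assumes U: "U \<subseteq> {..<p}" "p < n"
    and F: "\<And>P Q. finite P \<Longrightarrow> finite Q \<Longrightarrow> P \<inter> Q = {} \<Longrightarrow> F (P \<union> Q) = F P * F Q"
  shows "(\<Sum>P | partition_on ({..<n} - insert p U) P \<and> noncrossing (insert (insert n (insert p U)) P). F P) =
    (\<Sum>P | partition_on ({..<p} - U) P \<and> noncrossing (insert (insert p U) P). F P) *
    (\<Sum>Q | partition_on {p<..<n} Q \<and> noncrossing Q. F Q)"
proof -
  let ?A = "{..<p} - U" and ?B = "{p<..<n}"
  let ?L = "{P. partition_on ?A P \<and> noncrossing (insert (insert p U) P)}"
  let ?R = "{Q. partition_on ?B Q \<and> noncrossing Q}"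
  have AB: "{..<n} - insert p U = ?A \<union> ?B" "?A \<inter> ?B = {}"
    using U by auto
  have "(\<Sum>P\<in>?L. F P) * (\<Sum>Q\<in>?R. F Q) = (\<Sum>(P, Q)\<in>?L \<times> ?R. F P * F Q)"
    by (simp add: sum_product sum.cartesian_product)
  also have "\<dots> = (\<Sum>P | partition_on (?A \<union> ?B) P \<and> noncrossing (insert (insert n (insert p U)) P). F P)"
  proof (rule sum.reindex_bij_witness[where i = "\<lambda>P. ({V \<in> P. V \<subseteq> ?A}, {V \<in> P. V \<subseteq> ?B})"
        and j = "\<lambda>(P, Q). P \<union> Q"])
    fix PQ assume "PQ \<in> ?L \<times> ?R"
    then obtain P Q where PQ: "PQ = (P, Q)" "partition_on ?A P" "noncrossing (insert (insert p U) P)"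
        "partition_on ?B Q" "noncrossing Q"
      by auto
    have sub: "V \<subseteq> ?A" "V \<noteq> {}" if "V \<in> P" for V
      using that PQ(2) partition_on_subset[OF PQ(2)] partition_onD3[OF PQ(2)] by auto
    have sub': "V \<subseteq> ?B" "V \<noteq> {}" if "V \<in> Q" for V
      using that PQ(4) partition_on_subset[OF PQ(4)] partition_onD3[OF PQ(4)] by auto
    \<comment> \<open>Blocks are nonempty, so none lies in both \<open>?A\<close> and
      \<open>?B\<close>, and the pair can be recovered from the union.\<close>
    have disj: "\<not> V \<subseteq> ?A" if "V \<in> Q" for V
      using sub'[OF that] AB(2) by blast
    have disj': "\<not> V \<subseteq> ?B" if "V \<in> P" for V
      using sub[OF that] AB(2) by blast
    have eq: "{V \<in> P \<union> Q. V \<subseteq> ?A} = P" using sub(1) disj by auto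
    have eq': "{V \<in> P \<union> Q. V \<subseteq> ?B} = Q" using sub'(1) disj' by auto
    have eq'': "P \<inter> Q = {}" using sub(1) disj by auto
    show "(\<lambda>P. ({V \<in> P. V \<subseteq> ?A}, {V \<in> P. V \<subseteq> ?B})) (case PQ of (P, Q) \<Rightarrow> P \<union> Q) = PQ"
      using eq eq' by (simp add: PQ(1))
    have "partition_on (?A \<union> ?B) (P \<union> Q)"
      using PQ(2,4) AB(2) by (auto simp: partition_on_def intro!: disjoint_union)
    moreover have "noncrossing (insert (insert n (insert p U)) (P \<union> Q))"
      using noncrossing_cut[OF U, of P Q] sub sub' PQ(3,5) by simp
    ultimately show "(case PQ of (P, Q) \<Rightarrow> P \<union> Q) \<in>
        {P. partition_on (?A \<union> ?B) P \<and> noncrossing (insert (insert n (insert p U)) P)}"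
      by (simp add: PQ(1))
    have "finite P" "finite Q"
      using PQ(2,4) by (auto intro: finite_elements[rotated])
    then show "F (case PQ of (P, Q) \<Rightarrow> P \<union> Q) = (case PQ of (P, Q) \<Rightarrow> F P * F Q)"
      using F eq'' by (simp add: PQ(1))
  next
    fix P assume "P \<in> {P. partition_on (?A \<union> ?B) P \<and> noncrossing (insert (insert n (insert p U)) P)}"
    then have P: "partition_on (?A \<union> ?B) P" "noncrossing (insert (insert n (insert p U)) P)"
      by auto
    have sub: "V \<subseteq> ?A \<or> V \<subseteq> ?B" if "V \<in> P" for V
      using noncrossing_cut_blocks[OF P(2) that _ U(2)] partition_on_subset[OF P(1) that] AB(1) by simp
    let ?P = "{V \<in> P. V \<subseteq> ?A}" and ?Q = "{V \<in> P. V \<subseteq> ?B}"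
    have eq: "?P \<union> ?Q = P"
      using sub by blast
    show "(case (?P, ?Q) of (P, Q) \<Rightarrow> P \<union> Q) = P"
      using eq by simp
    have "partition_on ?A ?P"
      using P(1) AB(2) sub by (rule partition_on_part)
    moreover have "partition_on ?B ?Q"
      using P(1) AB(2) sub by (intro partition_on_part[of ?B ?A]) (simp_all add: Un_commute Int_commute disj_commute)
    moreover have "noncrossing (insert (insert p U) ?P) \<and> noncrossing ?Q"
      using noncrossing_cut[OF U, of ?P ?Q] P(2) eq by simp
    ultimately show "(?P, ?Q) \<in> ?L \<times> ?R"
      by simp
  qed
  finally show ?thesis
    unfolding AB(1) by simp
qed

text \<open>The position \<open>length xs\<close>, one past the end of \<open>xs\<close>, stands for
  the last point, and \<open>U\<close> prescribes the rest of its block; the cumulant of that block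
  is left out.\<close>

definition nc_sum :: "('a list \<Rightarrow> 'k::comm_ring_1) \<Rightarrow> 'a list \<Rightarrow> nat set \<Rightarrow> 'k" where
  "nc_sum C xs U = (\<Sum>P | partition_on ({..<length xs} - U) P \<and>
    noncrossing (insert (insert (length xs) U) P). block_prod C xs P)"

lemma nc_sum_empty: "nc_sum C xs {} = (\<Sum>P\<in>nc_partitions (length xs). block_prod C xs P)"
proof -
  have "noncrossing (insert {length xs} P) \<longleftrightarrow> noncrossing P" if "partition_on {..<length xs} P" for P
  proof -
    have "{length xs} \<notin> P"
      using partition_on_subset[OF that] by blast
    then show ?thesis
      by (simp add: noncrossing_insert crossing_singleton)
  qed
  then show ?thesis
    unfolding nc_sum_def nc_partitions_def set_partitions_def by (intro sum.cong) auto
qed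

text \<open>Cutting at \<open>p\<close>: the gap to its right contributes a full noncrossing sum,
  and \<open>p\<close> takes over the role of the last point for \<open>take p xs\<close>.\<close>

lemma nc_sum_insert:
  assumes "U \<subseteq> {..<p}" "p < length xs"
  shows "nc_sum C xs (insert p U) = nc_sum C (take p xs) U *
    (\<Sum>P\<in>nc_partitions (length xs - Suc p). block_prod C (drop (Suc p) xs) P)"
proof -
  let ?n = "length xs"
  have len: "length (take p xs) = p" using assms(2) by simp
  have "nc_sum C xs (insert p U) =
    (\<Sum>P | partition_on ({..<p} - U) P \<and> noncrossing (insert (insert p U) P). block_prod C xs P) *
    (\<Sum>Q | partition_on {p<..<?n} Q \<and> noncrossing Q. block_prod C xs Q)"
    unfolding nc_sum_def
    by (rule sum_partitions_cut[OF assms]) (simp add: block_prod_subword prod.union_disjoint)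
  also have "(\<Sum>P | partition_on ({..<p} - U) P \<and> noncrossing (insert (insert p U) P). block_prod C xs P) =
      nc_sum C (take p xs) U"
    unfolding nc_sum_def len
  proof (rule sum.cong[OF refl], clarify)
    fix P assume "partition_on ({..<p} - U) P"
    then have "V \<subseteq> {..<length (take p xs)}" if "V \<in> P" for V
      unfolding len using partition_on_subset that by blast
    then have "block_prod C (take p xs @ drop p xs) P = block_prod C (take p xs) P"
      by (rule block_prod_append)
    then show "block_prod C xs P = block_prod C (take p xs) P" by simp
  qed
  also have "(\<Sum>Q | partition_on {p<..<?n} Q \<and> noncrossing Q. block_prod C xs Q) =
      (\<Sum>P\<in>nc_partitions (?n - Suc p). block_prod C (drop (Suc p) xs) P)"
  proof -
    have "{p<..<?n} = {Suc p..<?n}" by auto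
    then have "subword xs {p<..<?n} = drop (Suc p) xs"
      by (simp add: subword_interval)
    then show ?thesis
      by (subst sum_partitions_enum)
        (simp_all add: nc_partitions_def set_partitions_def noncrossing_image_iff[OF strict_mono_on_enum])
  qed
  finally show ?thesis .
qed

text \<open>The largest element of \<open>U\<close> is the first chosen letter of the reversed word,
  so cutting there by \<open>nc_sum_insert\<close> reproduces \<open>gap_sum\<close>.\<close>

lemma nc_sum_gap:
  assumes M: "\<And>xs. M xs = (\<Sum>P\<in>nc_partitions (length xs). block_prod C xs P)"
  shows "(\<Sum>U\<in>Pow {..<length xs}. f (rev (subword xs U)) * nc_sum C xs U) =
    gap (\<lambda>w. M (rev w)) (\<lambda>w. M (rev w)) f (rev xs)"
proof (induction xs arbitrary: f rule: length_induct)
  case (1 xs)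
  let ?n = "length xs" and ?m = "\<lambda>w. M (rev w)"
  have step: "(\<Sum>U\<in>Pow {..<p}. f (rev (subword xs (insert p U))) * nc_sum C xs (insert p U)) =
      M (drop (Suc p) xs) * gap ?m ?m (\<lambda>u. f (xs ! p # u)) (rev (take p xs))" if p: "p < ?n" for p
  proof -
    have "f (rev (subword xs (insert p U))) * nc_sum C xs (insert p U) =
      M (drop (Suc p) xs) * (f (xs ! p # rev (subword (take p xs) U)) * nc_sum C (take p xs) U)"
      if "U \<subseteq> {..<p}" for U
    proof -
      have "finite U" "\<And>x. x \<in> U \<Longrightarrow> x < p"
        using that finite_subset by auto
      then show ?thesis
        using that p by (simp add: nc_sum_insert M subword_insert_greater subword_take ac_simps)
    qed
    then have "(\<Sum>U\<in>Pow {..<p}. f (rev (subword xs (insert p U))) * nc_sum C xs (insert p U)) =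
      M (drop (Suc p) xs) * (\<Sum>U\<in>Pow {..<length (take p xs)}.
        f (xs ! p # rev (subword (take p xs) U)) * nc_sum C (take p xs) U)"
      using p by (simp add: sum_distrib_left)
    also have "\<dots> = M (drop (Suc p) xs) * gap ?m ?m (\<lambda>u. f (xs ! p # u)) (rev (take p xs))"
      using 1[rule_format, of "take p xs" "\<lambda>u. f (xs ! p # u)"] p by simp
    finally show ?thesis .
  qed
  have empty: "nc_sum C xs {} = M xs"
    by (simp only: nc_sum_empty M)
  have "(\<Sum>U\<in>Pow {..<?n}. f (rev (subword xs U)) * nc_sum C xs U) =
    M xs * f [] + (\<Sum>p<?n. M (drop (Suc p) xs) * gap ?m ?m (\<lambda>u. f (xs ! p # u)) (rev (take p xs)))"
    by (subst sum_Pow_lessThan) (simp add: empty step mult.commute[of "f []"])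
  \<comment> \<open>Position \<open>i\<close> of \<open>rev xs\<close> is position
    \<open>p = ?n - Suc i\<close> of \<open>xs\<close>.\<close>
  also have "(\<Sum>p<?n. M (drop (Suc p) xs) * gap ?m ?m (\<lambda>u. f (xs ! p # u)) (rev (take p xs))) =
    (\<Sum>i<?n. M (drop (?n - i) xs) * gap ?m ?m (\<lambda>u. f (rev xs ! i # u)) (rev (take (?n - Suc i) xs)))"
    by (subst sum.nat_diff_reindex[symmetric]) (intro sum.cong refl, simp add: rev_nth Suc_diff_Suc)
  also have "M xs * f [] + \<dots> = gap ?m ?m f (rev xs)"
    by (subst gap_sum) (simp add: take_rev drop_rev)
  finally show ?case .
qed

lemma free_moments_snoc:
  assumes M: "\<And>xs. M xs = (\<Sum>P\<in>nc_partitions (length xs). block_prod C xs P)"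
  shows "M (xs @ [d]) = gap (\<lambda>w. M (rev w)) (\<lambda>w. M (rev w)) (\<lambda>u. C (rev u @ [d])) (rev xs)"
proof -
  have "M (xs @ [d]) = (\<Sum>U\<in>Pow {..<length xs}. C (subword xs U @ [d]) * nc_sum C xs U)"
    using sum_partitions_snoc[where Q = noncrossing]
    by (simp add: M nc_partitions_def set_partitions_def nc_sum_def)
  then show ?thesis
    using nc_sum_gap[OF M, where f = "\<lambda>u. C (rev u @ [d])" and xs = xs] by simp
qed

subsection \<open>Equivalence of the cumulant formulas\<close>

lemma BPT_snoc: "BPT (is @ [d]) = (\<lambda>t. (t, d)) ` {t. postorder t = is}"
  by (auto simp: BPT_def)

lemma sum_BPT:
  assumes "weighted_troupe tau"
  shows "(\<Sum>T\<in>BPT (rev w @ [d]). tau T) = plane_sum (chain_val tau [] d) w"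
proof -
  \<comment> \<open>At the empty tree this is the troupe condition
    \<open>tau (Leaf, d) = 0\<close>.\<close>
  have "chain_val tau [] d t = tau (t, d)" for t
    using assms by (simp add: chain_val_def weighted_troupe_def)
  then show ?thesis
    by (simp add: BPT_snoc plane_sum_def sum.reindex inj_on_def)
qed

lemma sum_Branch: "(\<Sum>T\<in>Branch (rev w @ [d]). tau T) = plane_sum (branch_val tau [] d) w"
proof -
  have "Branch (rev w @ [d]) = (\<lambda>t. (t, d)) ` {t \<in> {t. postorder t = rev w}. is_branch t}"
    by (auto simp: Branch_def BPT_snoc)
  then have "(\<Sum>T\<in>Branch (rev w @ [d]). tau T) = (\<Sum>t | postorder t = rev w \<and> is_branch t. tau (t, d))"
    by (simp add: sum.reindex inj_on_def)
  also have "\<dots> = plane_sum (branch_val tau [] d) w"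
    using sum.inter_filter[OF finite_trees_postorder[of w], of "\<lambda>t. tau (t, d)" is_branch]
    by (simp add: plane_sum_def branch_val_def cong: if_cong)
  finally show ?thesis .
qed

lemma sum_DBPT:
  assumes "weighted_troupe tau"
  shows "(\<Sum>L\<in>DBPT (rev w @ [d]). tau (underlying (rev w @ [d]) L)) = decreasing_sum (chain_val tau [] d) w"
  unfolding decreasing_sum_def
proof (rule sum.cong)
  show "DBPT (rev w @ [d]) = decreasing_trees {..<length w}"
    by (simp add: DBPT_def decreasing_trees_def)
  fix L assume L: "L \<in> decreasing_trees {..<length w}"
  have "map_tree ((!) (rev w @ [d])) L = map_tree ((!) (rev w)) L"
  proof (rule tree.map_cong0)
    fix j assume "j \<in> set_tree L"
    then show "(rev w @ [d]) ! j = rev w ! j"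
      using L by (simp add: decreasing_trees_def nth_append)
  qed
  moreover have "chain_val tau [] d t = tau (t, d)" for t
    using assms by (simp add: chain_val_def weighted_troupe_def)
  ultimately show "tau (underlying (rev w @ [d]) L) = chain_val tau [] d (map_tree ((!) (rev w)) L)"
    by (simp add: underlying_def)
qed

text \<open>The recursion \<open>b_Cons\<close> does not involve \<open>star\<close>, so the branch
  sums can be taken over plane trees for either choice of \<open>S\<close>.\<close>

lemma (in tree_sum) chain_family:
  assumes "weighted_troupe tau" "cumulant_transform m A star"
  shows "chain_family m A star (\<lambda>C d. S (chain_val tau C d)) (\<lambda>C d. plane_sum (branch_val tau C d))
    (\<lambda>C d c. tau (plug C (Node Leaf c Leaf), d))"
proof -
  interpret cumulant_transform m A star by fact
  interpret plane: tree_sum plane_sum deconc by (rule tree_sum_plane)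
  show ?thesis
  proof
    fix C d c w
    show "plane_sum (branch_val tau C d) (c # w) = plane_sum (branch_val tau (C @ [(False, c)]) d) w
      + plane_sum (branch_val tau (C @ [(True, c)]) d) w
      + unit_at_nil (tau (plug C (Node Leaf c Leaf), d)) w"
      by (rule plane.S_chain) (rule branch_val_Node)
  qed (simp_all add: chain_val_Cons[OF assms(1)] S_Nil plane.S_Nil chain_val_def branch_val_def is_branch_def)
qed

text \<open>The formula extends to the empty word: its only partition has no blocks, and the empty
  product matches \<open>phi 1 = 1\<close>. The recursions use this value for empty gaps and
  complements.\<close>

lemma cumulants_wrt_moments:
  assumes "cumulants_wrt Parts phi C" "phi 1 = 1" "Parts 0 = {{}}"
  shows "phi (prod_list xs) = (\<Sum>P\<in>Parts (length xs). block_prod C xs P)"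
proof (cases "xs = []")
  case True
  then show ?thesis using assms(2,3) by (simp add: block_prod_def)
next
  case False
  then show ?thesis using assms(1) by (simp add: cumulants_wrt_def)
qed

lemma partitions_0:
  "set_partitions 0 = {{}}" "nc_partitions 0 = {{}}" "int_partitions 0 = {{}}"
  by (auto simp: set_partitions_def nc_partitions_def int_partitions_def partition_on_empty
      noncrossing_def interval_partition_def)

lemma all_nonempty_words_iff: "(\<forall>is. is \<noteq> [] \<longrightarrow> Q is) \<longleftrightarrow> (\<forall>d w. Q (rev w @ [d]))"
proof
  assume *: "\<forall>d w. Q (rev w @ [d])"
  show "\<forall>is. is \<noteq> [] \<longrightarrow> Q is"
  proof (intro allI impI)
    fix "is" :: "'a list" assume "is \<noteq> []"
    then have "is = rev (rev (butlast is)) @ [last is]" by simp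
    then show "Q is" using * by metis
  qed
qed simp

lemma gap_map: "gap m \<mu> f (map X w) = gap (\<lambda>w. m (map X w)) (\<lambda>w. \<mu> (map X w)) (\<lambda>w. f (map X w)) w"
  by (induction w arbitrary: \<mu> f) simp_all

theorem theorem4p1:
  fixes scl :: "'k::comm_ring_1 \<Rightarrow> 'a::ring_1 \<Rightarrow> 'a"
    and phi :: "'a \<Rightarrow> 'k"
    and X :: "'i \<Rightarrow> 'a"
    and tau :: "'i cbpt \<Rightarrow> 'k"
    and K R B :: "'a list \<Rightarrow> 'k"
  assumes "nc_prob_space scl phi"
    and "classical_cumulants phi K"
    and "free_cumulants phi R"
    and "boolean_cumulants phi B"
    and "weighted_troupe tau"
  shows "((\<forall>is. is \<noteq> [] \<longrightarrow> - K (map X is) = (\<Sum>L\<in>DBPT is. tau (underlying is L)))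
          \<longleftrightarrow> (\<forall>is. is \<noteq> [] \<longrightarrow> - R (map X is) = (\<Sum>T\<in>BPT is. tau T)))
       \<and> ((\<forall>is. is \<noteq> [] \<longrightarrow> - R (map X is) = (\<Sum>T\<in>BPT is. tau T))
          \<longleftrightarrow> (\<forall>is. is \<noteq> [] \<longrightarrow> - B (map X is) = (\<Sum>T\<in>Branch is. tau T)))"
proof -
  define M where "M = (\<lambda>xs. phi (prod_list xs))"
  define m where "m = (\<lambda>w. M (map X (rev w)))"
  define rK where "rK = (\<lambda>w. K (map X (rev w)))"
  define rR where "rR = (\<lambda>w. R (map X (rev w)))"
  define rB where "rB = (\<lambda>w. B (map X (rev w)))"
  have phi1: "phi 1 = 1"
    using assms(1) by (simp add: nc_prob_space_def)
  then have m_Nil: "m [] = 1"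
    by (simp add: m_def M_def)
  have MK: "M xs = (\<Sum>P\<in>set_partitions (length xs). block_prod K xs P)" for xs
    unfolding M_def using assms(2) phi1 partitions_0(1)
    by (intro cumulants_wrt_moments) (simp_all add: classical_cumulants_def)
  have MR: "M xs = (\<Sum>P\<in>nc_partitions (length xs). block_prod R xs P)" for xs
    unfolding M_def using assms(3) phi1 partitions_0(2)
    by (intro cumulants_wrt_moments) (simp_all add: free_cumulants_def)
  have MB: "M xs = (\<Sum>P\<in>int_partitions (length xs). block_prod B xs P)" for xs
    unfolding M_def using assms(4) phi1 partitions_0(3)
    by (intro cumulants_wrt_moments) (simp_all add: boolean_cumulants_def)
  have mK: "m (d # w) = shuf (\<lambda>u. rK (d # u)) m w" for d w
  proof -
    have "m (d # w) = (\<Sum>U\<in>Pow {..<length (map X (rev w))}. K (subword (map X (rev w)) U @ [X d]) *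
        M (subword (map X (rev w)) ({..<length (map X (rev w))} - U)))"
      unfolding m_def by (simp add: classical_moments_snoc[OF MK])
    also have "\<dots> = shuf (\<lambda>u. rK (d # u)) m (rev (rev w))"
      unfolding shuf_sum by (intro sum.cong) (auto simp: rK_def m_def map_subword)
    finally show ?thesis by simp
  qed
  have mR: "m (d # w) = gap m m (\<lambda>u. rR (d # u)) w" for d w
  proof -
    have "m (d # w) = gap (\<lambda>w. M (rev w)) (\<lambda>w. M (rev w)) (\<lambda>u. R (rev u @ [X d])) (map X w)"
      unfolding m_def using free_moments_snoc[OF MR, of "map X (rev w)" "X d"] by (simp add: rev_map)
    also have "\<dots> = gap m m (\<lambda>u. rR (d # u)) w"
      unfolding gap_map by (simp add: m_def rR_def rev_map)
    finally show ?thesis .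
  qed
  have mB: "m (d # w) = deconc (\<lambda>u. rB (d # u)) m w" for d w
  proof -
    have "m (d # w) = (\<Sum>i\<le>length w. B (drop i (map X (rev w)) @ [X d]) * M (take i (map X (rev w))))"
      unfolding m_def by (simp add: boolean_moments_snoc[OF MB])
    \<comment> \<open>A final segment of a word is an initial segment of its reversal, so lengths
      are complemented.\<close>
    also have "\<dots> = (\<Sum>i\<le>length w. rB (d # take i w) * m (drop i w))"
      by (rule sum.reindex_bij_witness[where i = "\<lambda>i. length w - i" and j = "\<lambda>i. length w - i"])
        (auto simp: rB_def m_def rev_take rev_drop take_map drop_map)
    finally show ?thesis by (simp add: deconc_sum)
  qed
  interpret plane: tree_sum plane_sum deconc by (rule tree_sum_plane)
  interpret decr: tree_sum decreasing_sum shuf by (rule tree_sum_decreasing)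
  \<comment> \<open>Both instances carry the same branch sums, so the classical and the free formula
    are each equivalent to one and the same Boolean formula.\<close>
  interpret classical: chain_family m "\<lambda>f. shuf f m" shuf "\<lambda>C d. decreasing_sum (chain_val tau C d)"
    "\<lambda>C d. plane_sum (branch_val tau C d)" "\<lambda>C d c. tau (plug C (Node Leaf c Leaf), d)"
    by (rule decr.chain_family[OF assms(5) cumulant_transform_shuf[of m, OF m_Nil]])
  interpret free: chain_family m "gap m m" deconc "\<lambda>C d. plane_sum (chain_val tau C d)"
    "\<lambda>C d. plane_sum (branch_val tau C d)" "\<lambda>C d c. tau (plug C (Node Leaf c Leaf), d)"
    by (rule plane.chain_family[OF assms(5) cumulant_transform_gap[of m, OF m_Nil]])
  have "K (map X (rev w @ [d])) = rK (d # w)" "R (map X (rev w @ [d])) = rR (d # w)"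
    "B (map X (rev w @ [d])) = rB (d # w)" for w d
    by (simp_all add: rK_def rR_def rB_def)
  then show ?thesis
    unfolding all_nonempty_words_iff sum_BPT[OF assms(5)] sum_Branch sum_DBPT[OF assms(5)]
    using classical.cumulants_iff[of rK rB, OF mK mB] free.cumulants_iff[of rR rB, OF mR mB] by simp
qed

end
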